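(* Let $(G,X)$ and $(G,Y)$ be minimal topological dynamical systems and let $\pi:(G,X)\to(G,Y)$ be a dynamical morphism. Then for every integer $d\ge1$, $(\pi\times\pi)(\mathbf{NRP}^{[d]}(X))=\mathbf{NRP}^{[d]}(Y)$.
   Context: A topological dynamical system (t.d.s.) $(G,X)$ is a Hausdorff topological group $G$ acting continuously on a compact Hausdorff space $X$; it is minimal if every orbit $Gx$ is dense in $X$. A dynamical morphism $(G,X)\to(G,Y)$ is a continuous $G$-equivariant map $X\to Y$. For $d\ge 0$, $X^{[d]}$ is the set of maps $\{0,1\}^d\to X$ with the product topology, and for $x\in X$, $x^{[d]}\in X^{[d]}$ is the constant map with value $x$. For $h\in G$ and $F\subset\{0,1\}^d$, $[h]_F\in G^{[d]}=G^{\{0,1\}^d}$ is given by $[h]_F(\omega)=h$ if $\omega\in F$ and $[h]_F(\omega)=\mathrm{Id}$ otherwise. A hyperface of $\{0,1\}^d$ is a set $\{\omega:\omega_i=a\}$ with $1\le i\le d$, $a\in\{0,1\}$. The Host-Kra cube group $\mathcal{HK}^{[d]}$ is the subgroup of $G^{[d]}$ generated by all $[h]_F$ with $h\in G$ and $F$ a hyperface. It acts coordinatewise on $X^{[d]}$. The set of dynamical cubes is $C_G^{[d]}(X)=\overline{\{g x^{[d]}: g\in\mathcal{HK}^{[d]},\ x\in X\}}\subset X^{[d]}$. For $x,y\in X$, $\llcorner^{[d]}(x,y)\in X^{[d]}$ is the configuration with value $y$ at $\vec 1=(1,\dots,1)$ and value $x$ at all other $\omega\in\{0,1\}^d$. For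 $d\ge1$, the nilpotent regionally proximal relation of order $d$ is $\mathbf{NRP}^{[d]}(X)=\{(x,y)\in X\times X:\ \llcorner^{[d+1]}(x,y)\in C_G^{[d+1]}(X)\}$. *)

theory Defs
  imports
    "HOL-Algebra.Group_Action"
    "HOL-Algebra.Generated_Groups"
    "HOL-Algebra.Product_Groups"
    "HOL-Analysis.Analysis"
begin

locale Hausdorff_topological_group = group G for G (structure) +
  fixes T :: "'a topology"
  assumes topspace_group: "topspace T = carrier G"
    and Hausdorff_group: "Hausdorff_space T"
    and continuous_mult: "continuous_map (prod_topology T T) T (\<lambda>(g, h). g \<otimes> h)"
    and continuous_inv: "continuous_map T T (\<lambda>g. inv g)"

text \<open>
  The underlying set of the phase space is the topspace of \<open>X\<close>. Neither here nor in
  \<open>minimal\<close> is the phase space required to be nonempty.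
\<close>

locale tds =
  Hausdorff_topological_group G T + group_action G "topspace X" \<phi>
  for G (structure) and T and X :: "'x topology" and \<phi> +
  assumes compact_phase: "compact_space X"
    and Hausdorff_phase: "Hausdorff_space X"
    and continuous_action: "continuous_map (prod_topology T X) X (\<lambda>(g, x). \<phi> g x)"

locale minimal_tds = tds +
  assumes minimal: "x \<in> topspace X \<Longrightarrow> X closure_of (orbit G \<phi> x) = topspace X"

definition dynamical_morphism ::
  "('a, 'm) monoid_scheme \<Rightarrow> 'x topology \<Rightarrow> ('a \<Rightarrow> 'x \<Rightarrow> 'x) \<Rightarrow>
    'y topology \<Rightarrow> ('a \<Rightarrow> 'y \<Rightarrow> 'y) \<Rightarrow> ('x \<Rightarrow> 'y) \<Rightarrow> bool"
  where "dynamical_morphism G X \<phi> Y \<psi> \<pi> \<longleftrightarrow>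
    continuous_map X Y \<pi> \<and>
    (\<forall>g \<in> carrier G. \<forall>x \<in> topspace X. \<pi> (\<phi> g x) = \<psi> g (\<pi> x))"

text \<open>
  The discrete cube \<open>{0,1}\<^sup>d\<close>, with coordinates indexed by \<open>1, \<dots>, d\<close>. Its elements, and
  the configurations indexed by it, are extensional functions (\<open>undefined\<close> outside their
  domain), as for the library's product topologies and product groups.
\<close>

definition discrete_cube :: "nat \<Rightarrow> (nat \<Rightarrow> nat) set"
  where "discrete_cube d = {1..d} \<rightarrow>\<^sub>E {0, 1}"

definition hyperfaces :: "nat \<Rightarrow> (nat \<Rightarrow> nat) set set"
  where "hyperfaces d =
    {{\<omega> \<in> discrete_cube d. \<omega> i = a} | i a. i \<in> {1..d} \<and> a \<in> {0, 1}}"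

definition cube_topology :: "nat \<Rightarrow> 'x topology \<Rightarrow> ((nat \<Rightarrow> nat) \<Rightarrow> 'x) topology"
  where "cube_topology d X = product_topology (\<lambda>_. X) (discrete_cube d)"

definition cube_group ::
  "nat \<Rightarrow> ('a, 'm) monoid_scheme \<Rightarrow> ((nat \<Rightarrow> nat) \<Rightarrow> 'a) monoid"
  where "cube_group d G = product_group (discrete_cube d) (\<lambda>_. G)"

definition const_config :: "nat \<Rightarrow> 'x \<Rightarrow> (nat \<Rightarrow> nat) \<Rightarrow> 'x"
  where "const_config d x = (\<lambda>\<omega> \<in> discrete_cube d. x)"

definition face_element ::
  "('a, 'm) monoid_scheme \<Rightarrow> nat \<Rightarrow> 'a \<Rightarrow> (nat \<Rightarrow> nat) set \<Rightarrow> (nat \<Rightarrow> nat) \<Rightarrow> 'a"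
  where "face_element G d h F = (\<lambda>\<omega> \<in> discrete_cube d. if \<omega> \<in> F then h else \<one>\<^bsub>G\<^esub>)"

definition Host_Kra_group ::
  "('a, 'm) monoid_scheme \<Rightarrow> nat \<Rightarrow> ((nat \<Rightarrow> nat) \<Rightarrow> 'a) set"
  where "Host_Kra_group G d =
    generate (cube_group d G) {face_element G d h F | h F. h \<in> carrier G \<and> F \<in> hyperfaces d}"

definition cube_action ::
  "nat \<Rightarrow> ('a \<Rightarrow> 'x \<Rightarrow> 'x) \<Rightarrow> ((nat \<Rightarrow> nat) \<Rightarrow> 'a) \<Rightarrow> ((nat \<Rightarrow> nat) \<Rightarrow> 'x) \<Rightarrow> (nat \<Rightarrow> nat) \<Rightarrow> 'x"
  where "cube_action d \<phi> g c = (\<lambda>\<omega> \<in> discrete_cube d. \<phi> (g \<omega>) (c \<omega>))"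

definition dynamical_cubes ::
  "('a, 'm) monoid_scheme \<Rightarrow> 'x topology \<Rightarrow> ('a \<Rightarrow> 'x \<Rightarrow> 'x) \<Rightarrow> nat \<Rightarrow> ((nat \<Rightarrow> nat) \<Rightarrow> 'x) set"
  where "dynamical_cubes G X \<phi> d =
    cube_topology d X closure_of
      {cube_action d \<phi> g (const_config d x) | g x. g \<in> Host_Kra_group G d \<and> x \<in> topspace X}"

definition corner_config :: "nat \<Rightarrow> 'x \<Rightarrow> 'x \<Rightarrow> (nat \<Rightarrow> nat) \<Rightarrow> 'x"
  where "corner_config d x y =
    (\<lambda>\<omega> \<in> discrete_cube d. if \<omega> = (\<lambda>i \<in> {1..d}. 1) then y else x)"

definition NRP ::
  "('a, 'm) monoid_scheme \<Rightarrow> 'x topology \<Rightarrow> ('a \<Rightarrow> 'x \<Rightarrow> 'x) \<Rightarrow> nat \<Rightarrow> ('x \<times> 'x) set"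
  where "NRP G X \<phi> d =
    {(x, y) \<in> topspace X \<times> topspace X.
      corner_config (d + 1) x y \<in> dynamical_cubes G X \<phi> (d + 1)}"

end

theory Submission imports Defs begin

text \<open>
  Everything happens in \<open>X\<close>, where the elements of the enveloping semigroup \<open>E\<close> of \<open>G\<close> respect the
  fibres of \<open>\<pi>\<close>. Fix a minimal left ideal \<open>M\<close> of \<open>E\<close>, lifts \<open>x, x'\<close> of a pair in the relation of
  \<open>Y\<close>, and idempotents \<open>u, v\<close> of \<open>M\<close> with \<open>u x = x\<close> and \<open>v x' = x'\<close>. The corner configuration over
  \<open>Y\<close> lifts to some dynamical cube \<open>z\<close>, to which \<open>u\<close> is applied. Since the dynamical cubes are a minimal
  system of the Host-Kra group, each lower facet of \<open>z\<close> can be made constant by an element of the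
  enveloping semigroup of that group; doubling this element across the facet and treating the facets
  in turn gives a corner \<open>(a, b)\<close> that lies over \<open>(p x, p x')\<close> for some \<open>p \<in> M\<close>. Choose \<open>r \<in> E\<close> with
  \<open>r p = v\<close>. Then \<open>(r a, r b)\<close> is a corner over \<open>(v x, x')\<close>, and applying \<open>u\<close> along all lower
  facets yields the corner \<open>(u r a, r b)\<close>, which lies over \<open>(u v x, x') = (x, x')\<close>.
\<close>

section \<open>Compact right topological semigroups\<close>

text \<open>Zorn's lemma for reverse inclusion: a chain is bounded below by its intersection, which
  compactness keeps nonempty. It serves closed subsemigroups and closed left ideals alike.\<close>

lemma minimal_closed_member:
  assumes "compact_space W" and "\<K> \<noteq> {}"
    and closed: "\<And>K. K \<in> \<K> \<Longrightarrow> closedin W K \<and> K \<noteq> {}"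
    and chain: "\<And>\<C>. \<C> \<noteq> {} \<Longrightarrow> \<C> \<subseteq> \<K> \<Longrightarrow> \<Inter>\<C> \<noteq> {} \<Longrightarrow> \<Inter>\<C> \<in> \<K>"
  obtains M where "M \<in> \<K>" "\<And>K. K \<in> \<K> \<Longrightarrow> K \<subseteq> M \<Longrightarrow> K = M"
proof -
  have "\<exists>M\<in>\<K>. \<forall>K\<in>\<K>. M \<supseteq> K \<longrightarrow> K = M"
  proof (rule predicate_Zorn)
    show "partial_order_on \<K> (relation_of (\<supseteq>) \<K>)"
      by (rule partial_order_on_relation_ofI) auto
    fix \<C> assume "\<C> \<in> Chains (relation_of (\<supseteq>) \<K>)"
    then have sub: "\<C> \<subseteq> \<K>" and total: "\<And>A B. A \<in> \<C> \<Longrightarrow> B \<in> \<C> \<Longrightarrow> A \<subseteq> B \<or> B \<subseteq> A"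
      by (auto simp: Chains_def relation_of_def)
    show "\<exists>U\<in>\<K>. \<forall>A\<in>\<C>. A \<supseteq> U"
    proof (cases "\<C> = {}")
      case True
      then show ?thesis using \<open>\<K> \<noteq> {}\<close> by auto
    next
      case False
      \<comment> \<open>In a chain a finite intersection is one of the members, hence nonempty; this
        is the finite intersection property.\<close>
      have "\<Inter>\<F> \<in> \<C>" if "finite \<F>" "\<F> \<subseteq> \<C>" "\<F> \<noteq> {}" for \<F>
        using that(1,3,2)
      proof (induction rule: finite_ne_induct)
        case (insert A \<F>)
        then have "A \<inter> \<Inter>\<F> = A \<or> A \<inter> \<Inter>\<F> = \<Inter>\<F>"
          using total[of A "\<Inter>\<F>"] by blast
        then show ?case using insert by auto
      qed auto
      then have "\<Inter>\<F> \<noteq> {}" if "finite \<F>" "\<F> \<subseteq> \<C>" for \<F>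
        using that closed sub by (cases "\<F> = {}") blast+
      then have "\<Inter>\<C> \<noteq> {}"
        using \<open>compact_space W\<close>[unfolded compact_space_fip, rule_format, of \<C>] closed sub by blast
      then show ?thesis using chain[OF False sub] by blast
    qed
  qed
  then show thesis using that by blast
qed

locale compact_right_topological_semigroup =
  fixes W :: "'s topology" and mult :: "'s \<Rightarrow> 's \<Rightarrow> 's" (infixl \<open>\<odot>\<close> 70)
  assumes compact: "compact_space W" and Hausdorff: "Hausdorff_space W"
    and closed: "\<And>p q. p \<in> topspace W \<Longrightarrow> q \<in> topspace W \<Longrightarrow> p \<odot> q \<in> topspace W"
    and assoc: "\<And>p q r. p \<in> topspace W \<Longrightarrow> q \<in> topspace W \<Longrightarrow> r \<in> topspace W \<Longrightarrow>
      p \<odot> q \<odot> r = p \<odot> (q \<odot> r)"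
    and continuous_right: "\<And>q. q \<in> topspace W \<Longrightarrow> continuous_map W W (\<lambda>p. p \<odot> q)"
begin

lemma closedin_right_translate:
  assumes "closedin W K" "q \<in> topspace W"
  shows "closedin W ((\<lambda>p. p \<odot> q) ` K)"
  using assms compact Hausdorff continuous_right
  by (meson closed_map_def continuous_imp_closed_map)

text \<open>The Ellis-Numakura lemma. If \<open>L\<close> is a minimal closed subsemigroup and
  \<open>u\<close> lies in \<open>L\<close>, then \<open>L u\<close>, and after it the set of
  \<open>p\<close> in \<open>L\<close> with \<open>p u = u\<close>, is a closed subsemigroup, hence
  all of \<open>L\<close>. So \<open>u\<close> itself is one of those \<open>p\<close>.\<close>

lemma idempotent_exists:
  assumes "closedin W K" "K \<noteq> {}" and K: "\<And>p q. p \<in> K \<Longrightarrow> q \<in> K \<Longrightarrow> p \<odot> q \<in> K"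
  obtains u where "u \<in> K" "u \<odot> u = u"
proof -
  define \<K> where "\<K> = {L. closedin W L \<and> L \<noteq> {} \<and> L \<subseteq> K \<and> (\<forall>p\<in>L. \<forall>q\<in>L. p \<odot> q \<in> L)}"
  obtain L where "L \<in> \<K>" and L: "\<And>L'. L' \<in> \<K> \<Longrightarrow> L' \<subseteq> L \<Longrightarrow> L' = L"
  proof (rule minimal_closed_member[OF compact, of \<K>])
    show "\<K> \<noteq> {}" using assms by (auto simp: \<K>_def)
    show "\<Inter>\<C> \<in> \<K>" if "\<C> \<noteq> {}" "\<C> \<subseteq> \<K>" "\<Inter>\<C> \<noteq> {}" for \<C>
    proof -
      have "closedin W (\<Inter>\<C>)" using that by (intro closedin_Inter) (auto simp: \<K>_def)
      moreover have "\<Inter>\<C> \<subseteq> K" using that(1,2) unfolding \<K>_def by blast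
      moreover have "\<forall>p\<in>\<Inter>\<C>. \<forall>q\<in>\<Inter>\<C>. p \<odot> q \<in> \<Inter>\<C>"
        using that(2) unfolding \<K>_def by blast
      ultimately show ?thesis using that(3) by (simp add: \<K>_def)
    qed
  qed (auto simp: \<K>_def)
  then have cl: "closedin W L" and "L \<noteq> {}" and LK: "L \<subseteq> K"
    and mult: "\<And>p q. p \<in> L \<Longrightarrow> q \<in> L \<Longrightarrow> p \<odot> q \<in> L"
    by (auto simp: \<K>_def)
  then obtain u where u: "u \<in> L" by blast
  have top: "L \<subseteq> topspace W" using cl by (rule closedin_subset)
  have "(\<lambda>p. p \<odot> u) ` L \<in> \<K>"
  proof -
    have "p \<odot> u \<odot> (q \<odot> u) \<in> (\<lambda>p. p \<odot> u) ` L" if "p \<in> L" "q \<in> L" for p q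
      using that u top mult by (intro image_eqI[of _ _ "p \<odot> u \<odot> q"]) (auto simp: assoc subset_iff closed)
    then show ?thesis
      using u cl top LK mult closedin_right_translate[of L u] unfolding \<K>_def by blast
  qed
  then have "(\<lambda>p. p \<odot> u) ` L = L" using L mult u by blast
  \<comment> \<open>A solution of \<open>p \<odot> u = u\<close> makes the set \<open>L'\<close>
    below nonempty.\<close>
  then obtain p where p: "p \<in> L" "p \<odot> u = u" using u by (metis imageE)
  define L' where "L' = {p \<in> L. p \<odot> u = u}"
  have "L' = L \<inter> {p \<in> topspace W. p \<odot> u \<in> {u}}" using top by (auto simp: L'_def)
  moreover have "closedin W {p \<in> topspace W. p \<odot> u \<in> {u}}"
    using u top by (intro closedin_continuous_map_preimage[OF continuous_right])
      (auto intro: closedin_Hausdorff_singleton[OF Hausdorff])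
  ultimately have "closedin W L'" using cl by auto
  moreover have "p \<odot> q \<in> L'" if "p \<in> L'" "q \<in> L'" for p q
    using that u top mult by (auto simp: L'_def assoc subset_iff)
  ultimately have "L' \<in> \<K>" using p LK by (auto simp: \<K>_def L'_def)
  then have "L' = L" using L by (auto simp: L'_def)
  then show thesis using u LK that by (auto simp: L'_def)
qed

text \<open>Minimality in equational form: a nonempty left ideal contains no smaller one exactly
  when each of its points generates it.\<close>

definition minimal_left_ideal :: "'s set \<Rightarrow> bool"
  where "minimal_left_ideal M \<longleftrightarrow>
    M \<noteq> {} \<and> M \<subseteq> topspace W \<and> (\<forall>p\<in>M. (\<lambda>s. s \<odot> p) ` topspace W = M)"

lemma minimal_left_idealD:
  assumes "minimal_left_ideal M"
  shows "M \<noteq> {}" and "M \<subseteq> topspace W" and "p \<in> M \<Longrightarrow> (\<lambda>s. s \<odot> p) ` topspace W = M"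
  using assms by (simp_all add: minimal_left_ideal_def)

lemma minimal_left_ideal_closedin:
  assumes "minimal_left_ideal M"
  shows "closedin W M"
proof -
  obtain p where p: "p \<in> M" using minimal_left_idealD(1)[OF assms] by blast
  then have "p \<in> topspace W" using minimal_left_idealD(2)[OF assms] by blast
  then show ?thesis
    using closedin_right_translate[OF closedin_topspace, of p] minimal_left_idealD(3)[OF assms p]
    by simp
qed

lemma minimal_left_ideal_mult:
  assumes "minimal_left_ideal M" "s \<in> topspace W" "p \<in> M"
  shows "s \<odot> p \<in> M"
  using imageI[OF assms(2), of "\<lambda>s. s \<odot> p"] minimal_left_idealD(3)[OF assms(1,3)] by simp

lemma minimal_left_ideal_transitive:
  assumes M: "minimal_left_ideal M" and p: "p \<in> M" and q: "q \<in> M"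
  obtains s where "s \<in> topspace W" "s \<odot> p = q"
proof -
  have "q \<in> (\<lambda>s. s \<odot> p) ` topspace W" using minimal_left_idealD(3)[OF M p] q by simp
  then show thesis using that by (elim imageE) simp
qed

text \<open>By transitivity \<open>p = s u\<close>, so \<open>p u = s u u = s u = p\<close>. In
  particular two idempotents of \<open>M\<close> satisfy \<open>u v = u\<close>, which is how the
  lemma is used below.\<close>

lemma minimal_left_ideal_right_identity:
  assumes M: "minimal_left_ideal M" and "u \<in> M" "p \<in> M" "u \<odot> u = u"
  shows "p \<odot> u = p"
proof -
  obtain s where "s \<in> topspace W" "s \<odot> u = p"
    using minimal_left_ideal_transitive[OF assms(1-3)] by blast
  moreover have "u \<in> topspace W" using minimal_left_idealD(2)[OF M] \<open>u \<in> M\<close> by (rule subsetD)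
  ultimately show ?thesis using assms(4) assoc[of s u u] by simp
qed

text \<open>Zorn's lemma gives a minimal nonempty closed left ideal inside the one generated by
  \<open>q\<close>. Each of its points generates a closed left ideal contained in it, hence equal to
  it. The location inside the ideal of \<open>q\<close> later gives its elements the form
  \<open>S U\<close>.\<close>

lemma minimal_left_ideal_exists:
  assumes q: "q \<in> topspace W"
  obtains M where "minimal_left_ideal M" "M \<subseteq> (\<lambda>s. s \<odot> q) ` topspace W"
proof -
  let ?S = "topspace W"
  define \<K> where "\<K> = {L. closedin W L \<and> L \<noteq> {} \<and> L \<subseteq> (\<lambda>s. s \<odot> q) ` ?S \<and>
    (\<forall>s\<in>?S. \<forall>p\<in>L. s \<odot> p \<in> L)}"
  have translate: "(\<lambda>s. s \<odot> p) ` ?S \<in> \<K>" if p: "p \<in> (\<lambda>s. s \<odot> q) ` ?S" for p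
  proof -
    have ideal: "s \<odot> (t \<odot> r) \<in> (\<lambda>s. s \<odot> r) ` ?S" if "s \<in> ?S" "t \<in> ?S" "r \<in> ?S" for r s t
      using that by (intro image_eqI[of _ _ "s \<odot> t"]) (simp_all add: assoc closed)
    have "p \<in> ?S" using p q closed by blast
    moreover have "(\<lambda>s. s \<odot> p) ` ?S \<subseteq> (\<lambda>s. s \<odot> q) ` ?S" using p ideal q by blast
    moreover have "(\<lambda>s. s \<odot> p) ` ?S \<noteq> {}" using q by blast
    ultimately show ?thesis
      using ideal closedin_right_translate[OF closedin_topspace, of p] unfolding \<K>_def by blast
  qed
  obtain M where "M \<in> \<K>" and M: "\<And>L. L \<in> \<K> \<Longrightarrow> L \<subseteq> M \<Longrightarrow> L = M"
  proof (rule minimal_closed_member[OF compact, of \<K>])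
    show "\<K> \<noteq> {}" using translate q by blast
    show "\<Inter>\<C> \<in> \<K>" if "\<C> \<noteq> {}" "\<C> \<subseteq> \<K>" "\<Inter>\<C> \<noteq> {}" for \<C>
    proof -
      have "closedin W (\<Inter>\<C>)" using that by (intro closedin_Inter) (auto simp: \<K>_def)
      moreover have "\<Inter>\<C> \<subseteq> (\<lambda>s. s \<odot> q) ` ?S" using that(1,2) unfolding \<K>_def by blast
      moreover have "\<forall>s\<in>?S. \<forall>p\<in>\<Inter>\<C>. s \<odot> p \<in> \<Inter>\<C>"
        using that(2) unfolding \<K>_def by blast
      ultimately show ?thesis using that(3) by (simp add: \<K>_def)
    qed
  qed (auto simp: \<K>_def)
  from \<open>M \<in> \<K>\<close> have "closedin W M" "M \<noteq> {}" and Mq: "M \<subseteq> (\<lambda>s. s \<odot> q) ` ?S"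
    and ideal: "\<And>s p. s \<in> ?S \<Longrightarrow> p \<in> M \<Longrightarrow> s \<odot> p \<in> M"
    unfolding \<K>_def by blast+
  have "(\<lambda>s. s \<odot> p) ` ?S = M" if "p \<in> M" for p
  proof (rule M)
    show "(\<lambda>s. s \<odot> p) ` ?S \<in> \<K>" using translate Mq that by blast
    show "(\<lambda>s. s \<odot> p) ` ?S \<subseteq> M" using ideal that by blast
  qed
  then have "minimal_left_ideal M"
    using \<open>M \<noteq> {}\<close> closedin_subset[OF \<open>closedin W M\<close>] by (simp add: minimal_left_ideal_def)
  then show thesis using that Mq by blast
qed

end

section \<open>Enveloping semigroups\<close>

text \<open>
  A family of self-maps of \<open>X\<close> indexed by \<open>I\<close> is encoded as one extensional function on
  \<open>I \<times> topspace X\<close>, with the topology of pointwise convergence. In \<open>family_reindex\<close>, the index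
  \<open>None\<close> stands for the identity map.
\<close>

definition family_topology :: "'i set \<Rightarrow> 'x topology \<Rightarrow> ('i \<times> 'x \<Rightarrow> 'x) topology"
  where "family_topology I X = product_topology (\<lambda>_. X) (I \<times> topspace X)"

definition family_comp ::
  "'i set \<Rightarrow> 'x topology \<Rightarrow> ('i \<times> 'x \<Rightarrow> 'x) \<Rightarrow> ('i \<times> 'x \<Rightarrow> 'x) \<Rightarrow> 'i \<times> 'x \<Rightarrow> 'x"
  where "family_comp I X P Q = (\<lambda>(i, x) \<in> I \<times> topspace X. P (i, Q (i, x)))"

definition family_apply :: "'i set \<Rightarrow> ('i \<times> 'x \<Rightarrow> 'x) \<Rightarrow> ('i \<Rightarrow> 'x) \<Rightarrow> 'i \<Rightarrow> 'x"
  where "family_apply I P c = (\<lambda>i \<in> I. P (i, c i))"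

definition family_action ::
  "'i set \<Rightarrow> 'x topology \<Rightarrow> ('a \<Rightarrow> 'x \<Rightarrow> 'x) \<Rightarrow> ('i \<Rightarrow> 'a) \<Rightarrow> 'i \<times> 'x \<Rightarrow> 'x"
  where "family_action I X \<phi> g = (\<lambda>(i, x) \<in> I \<times> topspace X. \<phi> (g i) x)"

definition family_reindex ::
  "'i set \<Rightarrow> 'x topology \<Rightarrow> ('i \<Rightarrow> 'j option) \<Rightarrow> ('j \<times> 'x \<Rightarrow> 'x) \<Rightarrow> 'i \<times> 'x \<Rightarrow> 'x"
  where "family_reindex I X \<sigma> P =
    (\<lambda>(i, x) \<in> I \<times> topspace X. case \<sigma> i of None \<Rightarrow> x | Some j \<Rightarrow> P (j, x))"

text \<open>Families act coordinatewise, so pointwise convergence on configurations amounts to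
  pointwise convergence of every component. Hence this closure plays the role of the enveloping
  semigroup of the action on configurations indexed by \<open>I\<close>.\<close>

definition enveloping ::
  "'i set \<Rightarrow> 'x topology \<Rightarrow> ('a \<Rightarrow> 'x \<Rightarrow> 'x) \<Rightarrow> ('i \<Rightarrow> 'a) set \<Rightarrow> ('i \<times> 'x \<Rightarrow> 'x) set"
  where "enveloping I X \<phi> A = family_topology I X closure_of (family_action I X \<phi> ` A)"

lemma topspace_family_topology:
  "topspace (family_topology I X) = I \<times> topspace X \<rightarrow>\<^sub>E topspace X"
  by (simp add: family_topology_def)

lemma family_in_topspace:
  "P \<in> topspace (family_topology I X) \<Longrightarrow> i \<in> I \<Longrightarrow> x \<in> topspace X \<Longrightarrow> P (i, x) \<in> topspace X"
  by (auto simp: topspace_family_topology)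

lemma family_comp_apply:
  "i \<in> I \<Longrightarrow> x \<in> topspace X \<Longrightarrow> family_comp I X P Q (i, x) = P (i, Q (i, x))"
  by (simp add: family_comp_def)

lemma family_comp_assoc:
  assumes "Q \<in> topspace (family_topology I X)" "R \<in> topspace (family_topology I X)"
  shows "family_comp I X (family_comp I X P Q) R = family_comp I X P (family_comp I X Q R)"
  using family_in_topspace[OF assms(2)] by (auto simp: family_comp_def fun_eq_iff)

lemma continuous_map_family_coordinate:
  assumes "i \<in> I" "x \<in> topspace X"
  shows "continuous_map (family_topology I X) X (\<lambda>P. P (i, x))"
  unfolding family_topology_def using assms by (intro continuous_map_product_projection) auto

lemma continuous_map_into_family:
  assumes "\<And>i x. i \<in> I \<Longrightarrow> x \<in> topspace X \<Longrightarrow> continuous_map Z X (\<lambda>z. f z (i, x))"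
    and "\<And>z. z \<in> topspace Z \<Longrightarrow> f z \<in> extensional (I \<times> topspace X)"
  shows "continuous_map Z (family_topology I X) f"
  using assms unfolding family_topology_def
  by (auto simp: continuous_map_componentwise)

text \<open>Coordinate \<open>(i, x)\<close> of the composite is coordinate
  \<open>(i, Q (i, x))\<close> of \<open>P\<close>, so continuity in \<open>P\<close> holds for
  every \<open>Q\<close>, however discontinuous \<open>Q\<close> is on \<open>X\<close>.\<close>

lemma continuous_map_family_comp_right:
  assumes "Q \<in> topspace (family_topology I X)"
  shows "continuous_map (family_topology I X) (family_topology I X) (\<lambda>P. family_comp I X P Q)"
  by (rule continuous_map_into_family)
    (auto simp: family_comp_def family_in_topspace[OF assms] intro: continuous_map_family_coordinate)

lemma continuous_map_family_apply:
  assumes "c \<in> I \<rightarrow> topspace X"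
  shows "continuous_map (family_topology I X) (product_topology (\<lambda>_. X) I) (\<lambda>P. family_apply I P c)"
  unfolding continuous_map_componentwise
  using assms by (auto simp: family_apply_def intro: continuous_map_family_coordinate)

lemma continuous_map_family_reindex:
  assumes "\<And>i j. i \<in> I \<Longrightarrow> \<sigma> i = Some j \<Longrightarrow> j \<in> J"
  shows "continuous_map (family_topology J X) (family_topology I X) (family_reindex I X \<sigma>)"
proof (rule continuous_map_into_family)
  show "continuous_map (family_topology J X) X (\<lambda>P. family_reindex I X \<sigma> P (i, x))"
    if "i \<in> I" "x \<in> topspace X" for i x
    using assms[OF \<open>i \<in> I\<close>] that
    by (cases "\<sigma> i") (auto simp: family_reindex_def intro: continuous_map_family_coordinate)
qed (simp add: family_reindex_def)

lemma family_apply_comp: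
  assumes "c \<in> I \<rightarrow> topspace X"
  shows "family_apply I (family_comp I X P Q) c = family_apply I P (family_apply I Q c)"
  using assms by (auto simp: family_apply_def family_comp_def fun_eq_iff)

lemma family_comp_reindex:
  assumes "\<And>i j. i \<in> I \<Longrightarrow> \<sigma> i = Some j \<Longrightarrow> j \<in> J" "Q \<in> topspace (family_topology J X)"
  shows "family_reindex I X \<sigma> (family_comp J X P Q) =
    family_comp I X (family_reindex I X \<sigma> P) (family_reindex I X \<sigma> Q)"
  using family_in_topspace[OF assms(2)] assms(1)
  by (auto simp: family_reindex_def family_comp_def fun_eq_iff split: option.split)

lemma family_apply_reindex:
  assumes "c \<in> I \<rightarrow> topspace X" "i \<in> I"
  shows "family_apply I (family_reindex I X \<sigma> P) c i =
    (case \<sigma> i of None \<Rightarrow> c i | Some j \<Rightarrow> P (j, c i))"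
  using assms by (auto simp: family_apply_def family_reindex_def)

section \<open>Limits of group families on a dynamical system\<close>

context tds
begin

lemma action_closed: "g \<in> carrier G \<Longrightarrow> x \<in> topspace X \<Longrightarrow> \<phi> g x \<in> topspace X"
  using element_image[OF _ _ refl] by simp

lemma action_one: "x \<in> topspace X \<Longrightarrow> \<phi> \<one> x = x"
  using id_eq_one by (metis restrict_apply')

lemma continuous_map_action:
  assumes "g \<in> carrier G"
  shows "continuous_map X X (\<phi> g)"
proof -
  have "continuous_map X (prod_topology T X) (\<lambda>x. (g, x))"
    using assms by (intro continuous_map_pairedI) (auto simp: topspace_group)
  then have "continuous_map X X ((\<lambda>(g, x). \<phi> g x) \<circ> (\<lambda>x. (g, x)))"
    using continuous_action by (rule continuous_map_compose)
  then show ?thesis by (simp add: o_def)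
qed

lemma compact_space_family: "compact_space (family_topology I X)"
  unfolding family_topology_def by (simp add: compact_space_product_topology compact_phase)

lemma Hausdorff_space_family: "Hausdorff_space (family_topology I X)"
  unfolding family_topology_def by (simp add: Hausdorff_space_product_topology Hausdorff_phase)

lemma enveloping_subset_topspace: "enveloping I X \<phi> A \<subseteq> topspace (family_topology I X)"
  by (simp add: enveloping_def closure_of_subset_topspace)

lemma enveloping_in_topspace:
  "P \<in> enveloping I X \<phi> A \<Longrightarrow> i \<in> I \<Longrightarrow> x \<in> topspace X \<Longrightarrow> P (i, x) \<in> topspace X"
  using family_in_topspace[OF subsetD[OF enveloping_subset_topspace]] .

lemma family_action_in_topspace:
  assumes "\<And>i. i \<in> I \<Longrightarrow> g i \<in> carrier G"
  shows "family_action I X \<phi> g \<in> topspace (family_topology I X)"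
  using assms by (auto simp: family_action_def topspace_family_topology action_closed)

text \<open>Continuity in the right factor rests on the left factor being continuous on
  \<open>X\<close>. Group elements are, their limits in general are not.\<close>

lemma continuous_map_family_action_comp:
  assumes "\<And>i. i \<in> I \<Longrightarrow> g i \<in> carrier G"
  shows "continuous_map (family_topology I X) (family_topology I X)
    (family_comp I X (family_action I X \<phi> g))"
proof (rule continuous_map_into_family)
  fix i x assume i: "i \<in> I" and x: "x \<in> topspace X"
  have "continuous_map (family_topology I X) X (\<phi> (g i) \<circ> (\<lambda>P. P (i, x)))"
    using i x assms by (intro continuous_map_compose[OF continuous_map_family_coordinate] continuous_map_action)
  then show "continuous_map (family_topology I X) X
      (\<lambda>P. family_comp I X (family_action I X \<phi> g) P (i, x))"
    by (rule continuous_map_eq)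
      (use i x in \<open>auto simp: family_comp_def family_action_def family_in_topspace\<close>)
qed (simp add: family_comp_def)

text \<open>Density principle: a closed condition on a continuous image has to be checked only on
  the families of group elements. Most membership facts below are obtained this way.\<close>

lemma enveloping_image:
  assumes "P \<in> enveloping I X \<phi> A" "continuous_map (family_topology I X) Z f" "closedin Z K"
    and "\<And>g. g \<in> A \<Longrightarrow> f (family_action I X \<phi> g) \<in> K"
  shows "f P \<in> K"
proof -
  have "f P \<in> Z closure_of (f ` family_action I X \<phi> ` A)"
    using continuous_map_image_closure_subset[OF assms(2), of "family_action I X \<phi> ` A"]
      imageI[OF assms(1), of f] unfolding enveloping_def by (rule subsetD)
  also have "\<dots> \<subseteq> K" using assms by (intro closure_of_minimal) auto
  finally show ?thesis .
qed

lemma family_action_in_enveloping: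
  assumes "g \<in> A" "\<And>g i. g \<in> A \<Longrightarrow> i \<in> I \<Longrightarrow> g i \<in> carrier G"
  shows "family_action I X \<phi> g \<in> enveloping I X \<phi> A"
proof -
  have "family_action I X \<phi> ` A \<subseteq> topspace (family_topology I X)"
    using assms(2) by (auto intro: family_action_in_topspace)
  then show ?thesis
    unfolding enveloping_def using closure_of_subset assms(1) by (meson imageI subsetD)
qed

text \<open>Reindexing is continuous and takes group families in \<open>A\<close> to group families
  in \<open>B\<close>, so it takes limits to limits. This transfers diagonal, face and doubling
  constructions from groups to enveloping semigroups.\<close>

lemma enveloping_reindex:
  assumes P: "P \<in> enveloping J X \<phi> A"
    and \<sigma>: "\<And>i j. i \<in> I \<Longrightarrow> \<sigma> i = Some j \<Longrightarrow> j \<in> J"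
    and B: "\<And>g i. g \<in> B \<Longrightarrow> i \<in> I \<Longrightarrow> g i \<in> carrier G"
    and AB: "\<And>g. g \<in> A \<Longrightarrow> \<exists>h\<in>B. \<forall>i\<in>I. h i = (case \<sigma> i of None \<Rightarrow> \<one> | Some j \<Rightarrow> g j)"
  shows "family_reindex I X \<sigma> P \<in> enveloping I X \<phi> B"
proof (rule enveloping_image[OF P continuous_map_family_reindex[OF \<sigma>]])
  show "closedin (family_topology I X) (enveloping I X \<phi> B)"
    by (simp add: enveloping_def)
  fix g assume "g \<in> A"
  then obtain h where h: "h \<in> B" "\<And>i. i \<in> I \<Longrightarrow> h i = (case \<sigma> i of None \<Rightarrow> \<one> | Some j \<Rightarrow> g j)"
    using AB by blast
  have "family_reindex I X \<sigma> (family_action J X \<phi> g) = family_action I X \<phi> h"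
    using h(2) \<sigma>
    by (auto simp: family_reindex_def family_action_def fun_eq_iff action_one split: option.split)
  then show "family_reindex I X \<sigma> (family_action J X \<phi> g) \<in> enveloping I X \<phi> B"
    using family_action_in_enveloping[OF h(1), of I] B by simp
qed

end

text \<open>Products are compared only on \<open>I\<close>, so that functions on the unit type and
  extensional functions on the cube both fit.\<close>

locale acting_family = tds G T X \<phi>
  for G :: "('a, 'm) monoid_scheme" (structure) and T and X :: "'x topology" and \<phi> +
  fixes I :: "'i set" and A :: "('i \<Rightarrow> 'a) set"
  assumes family_nonempty: "A \<noteq> {}"
    and family_carrier: "g \<in> A \<Longrightarrow> i \<in> I \<Longrightarrow> g i \<in> carrier G"
    and family_mult: "g \<in> A \<Longrightarrow> h \<in> A \<Longrightarrow> \<exists>k\<in>A. \<forall>i\<in>I. k i = g i \<otimes> h i"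
begin

text \<open>Two limits taken in order: first \<open>Q\<close> runs to its limit with a group family
  on the left, then \<open>P\<close> runs to its limit with \<open>Q\<close> fixed. The reverse
  order would need left composition with a limit to be continuous.\<close>

lemma enveloping_mult_closed:
  assumes P: "P \<in> enveloping I X \<phi> A" and Q: "Q \<in> enveloping I X \<phi> A"
  shows "family_comp I X P Q \<in> enveloping I X \<phi> A"
proof -
  have cl: "closedin (family_topology I X) (enveloping I X \<phi> A)" by (simp add: enveloping_def)
  have left: "family_comp I X (family_action I X \<phi> g) Q \<in> enveloping I X \<phi> A" if g: "g \<in> A" for g
  proof (rule enveloping_image[OF Q continuous_map_family_action_comp cl])
    show "g i \<in> carrier G" if "i \<in> I" for i using g that by (rule family_carrier)
    fix h assume h: "h \<in> A"
    obtain k where k: "k \<in> A" "\<And>i. i \<in> I \<Longrightarrow> k i = g i \<otimes> h i"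
      using family_mult[OF g h] by blast
    have "family_comp I X (family_action I X \<phi> g) (family_action I X \<phi> h) = family_action I X \<phi> k"
      using g h k(2) family_carrier
      by (auto simp: family_comp_def family_action_def fun_eq_iff action_closed composition_rule)
    then show "family_comp I X (family_action I X \<phi> g) (family_action I X \<phi> h) \<in> enveloping I X \<phi> A"
      using family_action_in_enveloping[OF k(1), of I] family_carrier by simp
  qed
  show ?thesis
    by (rule enveloping_image[OF P continuous_map_family_comp_right cl left])
      (rule subsetD[OF enveloping_subset_topspace Q])
qed

lemma topspace_enveloping:
  "topspace (subtopology (family_topology I X) (enveloping I X \<phi> A)) = enveloping I X \<phi> A"
  using enveloping_subset_topspace by (auto simp: topspace_subtopology)

sublocale E: compact_right_topological_semigroup
  "subtopology (family_topology I X) (enveloping I X \<phi> A)" "family_comp I X"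
proof
  let ?E = "enveloping I X \<phi> A"
  have cl: "closedin (family_topology I X) ?E" by (simp add: enveloping_def)
  show "compact_space (subtopology (family_topology I X) ?E)"
    by (intro compact_space_subtopology closedin_compact_space[OF compact_space_family cl])
  show "Hausdorff_space (subtopology (family_topology I X) ?E)"
    by (intro Hausdorff_space_subtopology Hausdorff_space_family)
  show "family_comp I X p q \<in> topspace (subtopology (family_topology I X) ?E)"
    if "p \<in> topspace (subtopology (family_topology I X) ?E)"
      "q \<in> topspace (subtopology (family_topology I X) ?E)" for p q
    using that unfolding topspace_enveloping by (rule enveloping_mult_closed)
  show "family_comp I X (family_comp I X p q) r = family_comp I X p (family_comp I X q r)"
    if "q \<in> topspace (subtopology (family_topology I X) ?E)"
      "r \<in> topspace (subtopology (family_topology I X) ?E)" for p q r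
    using that by (intro family_comp_assoc) auto
  show "continuous_map (subtopology (family_topology I X) ?E) (subtopology (family_topology I X) ?E)
      (\<lambda>p. family_comp I X p q)"
    if q: "q \<in> topspace (subtopology (family_topology I X) ?E)" for q
  proof (rule continuous_map_into_subtopology)
    show "continuous_map (subtopology (family_topology I X) ?E) (family_topology I X)
        (\<lambda>p. family_comp I X p q)"
      using q by (intro continuous_map_from_subtopology continuous_map_family_comp_right) auto
    show "(\<lambda>p. family_comp I X p q) \<in> topspace (subtopology (family_topology I X) ?E) \<rightarrow> ?E"
      using q unfolding topspace_enveloping by (intro funcsetI enveloping_mult_closed)
  qed
qed

lemma enveloping_nonempty: "enveloping I X \<phi> A \<noteq> {}"
proof -
  obtain g where "g \<in> A" using family_nonempty by blast
  then have "family_action I X \<phi> g \<in> enveloping I X \<phi> A"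
    by (rule family_action_in_enveloping) (rule family_carrier)
  then show ?thesis by blast
qed

end

section \<open>Host-Kra groups and dynamical cubes\<close>

lemma discrete_cube_update:
  assumes "\<omega> \<in> discrete_cube n" "i \<in> {1..n}"
  shows "fun_upd \<omega> i 0 \<in> discrete_cube n"
  using assms by (auto simp: discrete_cube_def PiE_iff extensional_def)

lemma discrete_cube_values:
  assumes "\<omega> \<in> discrete_cube n" "i \<in> {1..n}"
  shows "\<omega> i = 0 \<or> \<omega> i = 1"
  using assms by (auto simp: discrete_cube_def PiE_iff)

lemma discrete_cube_ones: "(\<lambda>i \<in> {1..n}. 1) \<in> discrete_cube n"
  by (auto simp: discrete_cube_def)

lemma discrete_cube_not_ones:
  assumes "\<omega> \<in> discrete_cube n" "\<omega> \<noteq> (\<lambda>i \<in> {1..n}. 1)"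
  obtains i where "i \<in> {1..n}" "\<omega> i = 0"
proof -
  have "\<exists>i\<in>{1..n}. \<omega> i \<noteq> 1"
  proof (rule ccontr)
    assume "\<not> ?thesis"
    then have "\<omega> = (\<lambda>i \<in> {1..n}. 1)"
      using assms(1) by (intro extensionalityI[of _ "{1..n}"]) (auto simp: discrete_cube_def PiE_iff)
    then show False using assms(2) by contradiction
  qed
  then show thesis using that discrete_cube_values[OF assms(1)] by blast
qed

lemma hyperface_lower: "i \<in> {1..n} \<Longrightarrow> {\<omega> \<in> discrete_cube n. \<omega> i = 0} \<in> hyperfaces n"
  by (auto simp: hyperfaces_def)

lemma hyperface_upper: "i \<in> {1..n} \<Longrightarrow> {\<omega> \<in> discrete_cube n. \<omega> i = 1} \<in> hyperfaces n"
  by (auto simp: hyperfaces_def)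

section \<open>Diagonal elements and doubling in the Host-Kra group\<close>

context group
begin

lemma group_cube_group: "Group.group (cube_group n G)"
  unfolding cube_group_def by (intro product_group group_axioms)

lemma face_element_in_carrier:
  "h \<in> carrier G \<Longrightarrow> face_element G n h F \<in> carrier (cube_group n G)"
  by (auto simp: cube_group_def face_element_def)

lemma Host_Kra_group_subset_carrier: "Host_Kra_group G n \<subseteq> carrier (cube_group n G)"
  unfolding Host_Kra_group_def
  by (intro group.generate_incl[OF group_cube_group]) (auto intro: face_element_in_carrier)

lemma Host_Kra_group_coordinate:
  assumes "g \<in> Host_Kra_group G n" "\<omega> \<in> discrete_cube n"
  shows "g \<omega> \<in> carrier G"
  using subsetD[OF Host_Kra_group_subset_carrier assms(1)] assms(2) by (auto simp: cube_group_def)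

lemma Host_Kra_group_one: "\<one>\<^bsub>cube_group n G\<^esub> \<in> Host_Kra_group G n"
  unfolding Host_Kra_group_def by (rule generate.one)

lemma Host_Kra_group_mult:
  "g \<in> Host_Kra_group G n \<Longrightarrow> h \<in> Host_Kra_group G n \<Longrightarrow> g \<otimes>\<^bsub>cube_group n G\<^esub> h \<in> Host_Kra_group G n"
  unfolding Host_Kra_group_def by (rule generate.eng)

lemma Host_Kra_group_inv:
  assumes "g \<in> Host_Kra_group G n"
  shows "inv\<^bsub>cube_group n G\<^esub> g \<in> Host_Kra_group G n"
  using assms unfolding Host_Kra_group_def
  by (intro group.generate_m_inv_closed[OF group_cube_group]) (auto intro: face_element_in_carrier)

lemma cube_group_mult_apply:
  "\<omega> \<in> discrete_cube n \<Longrightarrow> (g \<otimes>\<^bsub>cube_group n G\<^esub> h) \<omega> = g \<omega> \<otimes> h \<omega>"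
  by (simp add: cube_group_def)

lemma cube_group_one_apply: "\<omega> \<in> discrete_cube n \<Longrightarrow> \<one>\<^bsub>cube_group n G\<^esub> \<omega> = \<one>"
  by (simp add: cube_group_def)

lemma cube_group_inv_apply:
  assumes "g \<in> carrier (cube_group n G)" "\<omega> \<in> discrete_cube n"
  shows "(inv\<^bsub>cube_group n G\<^esub> g) \<omega> = inv (g \<omega>)"
  using assms inv_product_group[of g "discrete_cube n" "\<lambda>_. G"] group_axioms
  by (simp add: cube_group_def)

lemma face_element_in_Host_Kra_group:
  "h \<in> carrier G \<Longrightarrow> F \<in> hyperfaces n \<Longrightarrow> face_element G n h F \<in> Host_Kra_group G n"
  unfolding Host_Kra_group_def by (rule generate.incl) auto

text \<open>The two opposite hyperfaces in direction 1 partition the cube; \<open>n \<ge> 1\<close>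
  provides this direction.\<close>

lemma diagonal_in_Host_Kra_group:
  assumes h: "h \<in> carrier G" and n: "n \<ge> 1"
  shows "\<exists>k\<in>Host_Kra_group G n. \<forall>\<omega>\<in>discrete_cube n. k \<omega> = h"
proof -
  define L where "L = face_element G n h {\<omega> \<in> discrete_cube n. \<omega> 1 = 0}"
  define U where "U = face_element G n h {\<omega> \<in> discrete_cube n. \<omega> 1 = 1}"
  have "L \<otimes>\<^bsub>cube_group n G\<^esub> U \<in> Host_Kra_group G n"
    unfolding L_def U_def using n
    by (intro Host_Kra_group_mult face_element_in_Host_Kra_group[OF h] hyperface_lower hyperface_upper) auto
  moreover have "(L \<otimes>\<^bsub>cube_group n G\<^esub> U) \<omega> = h" if "\<omega> \<in> discrete_cube n" for \<omega>
    using discrete_cube_values[OF that, of 1] n h that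
    by (auto simp: cube_group_mult_apply L_def U_def face_element_def)
  ultimately show ?thesis by blast
qed

text \<open>Precomposition with the projection onto the facet \<open>\<omega> i = 0\<close> respects
  products and inverses, so generators suffice. A hyperface in another direction is unchanged, the
  lower one in direction \<open>i\<close> becomes the whole cube, and the upper one becomes
  empty.\<close>

lemma doubling_in_Host_Kra_group:
  assumes g: "g \<in> Host_Kra_group G n" and i: "i \<in> {1..n}"
  shows "\<exists>k\<in>Host_Kra_group G n. \<forall>\<omega>\<in>discrete_cube n. k \<omega> = g (fun_upd \<omega> i 0)"
proof -
  have generator: "\<exists>k\<in>Host_Kra_group G n. \<forall>\<omega>\<in>discrete_cube n. k \<omega> = face_element G n h F (fun_upd \<omega> i 0)"
    if h: "h \<in> carrier G" and F: "F \<in> hyperfaces n" for h F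
  proof -
    obtain j a where F_eq: "F = {\<omega> \<in> discrete_cube n. \<omega> j = a}" and j: "j \<in> {1..n}" and a: "a \<in> {0, 1}"
      using F unfolding hyperfaces_def by blast
    consider "j \<noteq> i" | "j = i" "a = 0" | "j = i" "a = 1" using a by auto
    then show ?thesis
    proof cases
      case 1
      then show ?thesis
        using face_element_in_Host_Kra_group[OF h F] i
        by (intro bexI[of _ "face_element G n h F"]) (auto simp: face_element_def F_eq discrete_cube_update)
    next
      case 2
      then show ?thesis
        using diagonal_in_Host_Kra_group[OF h, of n] i
        by (auto simp: face_element_def F_eq discrete_cube_update)
    next
      case 3
      then show ?thesis
        using Host_Kra_group_one[of n] i
        by (intro bexI[of _ "\<one>\<^bsub>cube_group n G\<^esub>"])
          (auto simp: face_element_def F_eq discrete_cube_update cube_group_one_apply)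
    qed
  qed
  from g show ?thesis unfolding Host_Kra_group_def
  proof (induction rule: generate.induct)
    case one
    have "\<one>\<^bsub>cube_group n G\<^esub> \<omega> = \<one>\<^bsub>cube_group n G\<^esub> (fun_upd \<omega> i 0)" if "\<omega> \<in> discrete_cube n" for \<omega>
      using cube_group_one_apply[OF that] cube_group_one_apply[OF discrete_cube_update[OF that i]]
      by (rule trans[OF _ sym])
    then show ?case using generate.one by blast
  next
    case (incl h)
    then show ?case using generator unfolding Host_Kra_group_def by blast
  next
    \<comment> \<open>The rule of \<open>generate\<close> inverts generators only, so
      \<open>generator\<close> applies to \<open>f\<close> directly.\<close>
    case (inv f)
    then obtain h F where h: "h \<in> carrier G" "F \<in> hyperfaces n" and f: "f = face_element G n h F"
      by blast
    obtain k where k: "k \<in> Host_Kra_group G n" "\<forall>\<omega>\<in>discrete_cube n. k \<omega> = f (fun_upd \<omega> i 0)"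
      using generator[OF h] f by blast
    have "(inv\<^bsub>cube_group n G\<^esub> k) \<omega> = (inv\<^bsub>cube_group n G\<^esub> f) (fun_upd \<omega> i 0)"
      if "\<omega> \<in> discrete_cube n" for \<omega>
      using that k i f face_element_in_carrier[OF h(1)] subsetD[OF Host_Kra_group_subset_carrier k(1)]
      by (simp add: cube_group_inv_apply discrete_cube_update)
    then show ?case
      using Host_Kra_group_inv[OF k(1)] unfolding Host_Kra_group_def by blast
  next
    case (eng f1 f2)
    then obtain k1 k2 where k: "k1 \<in> Host_Kra_group G n" "\<forall>\<omega>\<in>discrete_cube n. k1 \<omega> = f1 (fun_upd \<omega> i 0)"
      "k2 \<in> Host_Kra_group G n" "\<forall>\<omega>\<in>discrete_cube n. k2 \<omega> = f2 (fun_upd \<omega> i 0)"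
      unfolding Host_Kra_group_def by blast
    have "(k1 \<otimes>\<^bsub>cube_group n G\<^esub> k2) \<omega> = (f1 \<otimes>\<^bsub>cube_group n G\<^esub> f2) (fun_upd \<omega> i 0)"
      if "\<omega> \<in> discrete_cube n" for \<omega>
      using that k i by (simp add: cube_group_mult_apply discrete_cube_update)
    then show ?case
      using Host_Kra_group_mult[OF k(1,3)] unfolding Host_Kra_group_def by blast
  qed
qed

end

context acting_family
begin

text \<open>Images of the compact enveloping semigroup are closed; an evaluation image containing a
  dense set is therefore everything.\<close>

lemma closedin_enveloping_image:
  assumes "continuous_map (family_topology I X) Z f" "Hausdorff_space Z"
  shows "closedin Z (f ` enveloping I X \<phi> A)"
  using continuous_imp_closed_map[OF assms(1) compact_space_family assms(2)]
  by (simp add: closed_map_def enveloping_def)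

end

section \<open>Enveloping semigroups acting on points and on dynamical cubes\<close>

context tds
begin

text \<open>With a single index the construction yields the enveloping semigroup of \<open>G\<close>
  on \<open>X\<close> itself.\<close>

sublocale point: acting_family G T X \<phi> "{()}" "(\<lambda>g _. g) ` carrier G"
  by unfold_locales auto

sublocale cube: acting_family G T X \<phi> "discrete_cube n" "Host_Kra_group G n" for n
proof unfold_locales
  show "Host_Kra_group G n \<noteq> {}" using Host_Kra_group_one by blast
  show "g i \<in> carrier G" if "g \<in> Host_Kra_group G n" "i \<in> discrete_cube n" for g i
    using that by (rule Host_Kra_group_coordinate)
  show "\<exists>k\<in>Host_Kra_group G n. \<forall>i\<in>discrete_cube n. k i = g i \<otimes> h i"
    if "g \<in> Host_Kra_group G n" "h \<in> Host_Kra_group G n" for g h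
    using Host_Kra_group_mult[OF that] by (rule bexI[rotated]) (simp add: cube_group_mult_apply)
qed

abbreviation ellis :: "(unit \<times> 'x \<Rightarrow> 'x) set"
  where "ellis \<equiv> enveloping {()} X \<phi> ((\<lambda>g _. g) ` carrier G)"

abbreviation cube_ellis :: "nat \<Rightarrow> ((nat \<Rightarrow> nat) \<times> 'x \<Rightarrow> 'x) set"
  where "cube_ellis n \<equiv> enveloping (discrete_cube n) X \<phi> (Host_Kra_group G n)"

abbreviation diagonal_family :: "nat \<Rightarrow> (unit \<times> 'x \<Rightarrow> 'x) \<Rightarrow> (nat \<Rightarrow> nat) \<times> 'x \<Rightarrow> 'x"
  where "diagonal_family n \<equiv> family_reindex (discrete_cube n) X (\<lambda>_. Some ())"

lemma diagonal_family_in_cube_ellis: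
  assumes "p \<in> ellis" "n \<ge> 1"
  shows "diagonal_family n p \<in> cube_ellis n"
  by (rule enveloping_reindex[OF assms(1)])
    (use diagonal_in_Host_Kra_group assms(2) cube.family_carrier in auto)

lemma face_family_in_cube_ellis:
  assumes "p \<in> ellis" "F \<in> hyperfaces n"
  shows "family_reindex (discrete_cube n) X (\<lambda>\<omega>. if \<omega> \<in> F then Some () else None) p \<in> cube_ellis n"
proof (rule enveloping_reindex[OF assms(1)])
  fix g :: "unit \<Rightarrow> 'a" assume "g \<in> (\<lambda>g _. g) ` carrier G"
  then have "face_element G n (g ()) F \<in> Host_Kra_group G n"
    using assms(2) by (auto intro: face_element_in_Host_Kra_group)
  then show "\<exists>h\<in>Host_Kra_group G n. \<forall>\<omega>\<in>discrete_cube n.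
      h \<omega> = (case if \<omega> \<in> F then Some () else None of None \<Rightarrow> \<one> | Some j \<Rightarrow> g j)"
    by (rule bexI[rotated]) (simp add: face_element_def)
qed (use cube.family_carrier in auto)

lemma doubling_in_cube_ellis:
  assumes "P \<in> cube_ellis n" "i \<in> {1..n}"
  shows "family_reindex (discrete_cube n) X (\<lambda>\<omega>. Some (fun_upd \<omega> i 0)) P \<in> cube_ellis n"
  by (rule enveloping_reindex[OF assms(1)])
    (use doubling_in_Host_Kra_group assms(2) cube.family_carrier discrete_cube_update in auto)

text \<open>Each component of a limit of Host-Kra elements is a limit of elements of
  \<open>G\<close>. Through this, minimal left ideals of \<open>ellis\<close> control those of
  \<open>cube_ellis\<close>.\<close>

lemma coordinate_in_ellis:
  assumes "P \<in> cube_ellis n" "\<omega> \<in> discrete_cube n"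
  shows "family_reindex {()} X (\<lambda>_. Some \<omega>) P \<in> ellis"
  by (rule enveloping_reindex[OF assms(1)]) (use assms(2) cube.family_carrier in auto)

lemma closedin_dynamical_cubes: "closedin (cube_topology n X) (dynamical_cubes G X \<phi> n)"
  by (simp add: dynamical_cubes_def)

lemma dynamical_cubes_in_topspace:
  assumes "z \<in> dynamical_cubes G X \<phi> n" "\<omega> \<in> discrete_cube n"
  shows "z \<omega> \<in> topspace X"
  using closedin_subset[OF closedin_dynamical_cubes[of n]] assms by (auto simp: cube_topology_def)

lemma continuous_map_cube_action:
  assumes "g \<in> Host_Kra_group G n"
  shows "continuous_map (cube_topology n X) (cube_topology n X) (cube_action n \<phi> g)"
proof -
  have "continuous_map (cube_topology n X) X (\<lambda>c. \<phi> (g \<omega>) (c \<omega>))" if "\<omega> \<in> discrete_cube n" for \<omega>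
    using continuous_map_compose[OF continuous_map_product_projection[OF that]
        continuous_map_action[OF Host_Kra_group_coordinate[OF assms that]]]
    by (simp add: cube_topology_def o_def)
  then show ?thesis
    unfolding cube_topology_def continuous_map_componentwise by (auto simp: cube_action_def)
qed

lemma cube_action_in_dynamical_cubes:
  assumes g: "g \<in> Host_Kra_group G n" and z: "z \<in> dynamical_cubes G X \<phi> n"
  shows "cube_action n \<phi> g z \<in> dynamical_cubes G X \<phi> n"
proof -
  let ?S = "{cube_action n \<phi> g (const_config n x) | g x. g \<in> Host_Kra_group G n \<and> x \<in> topspace X}"
  have "cube_action n \<phi> g z \<in> (cube_topology n X closure_of (cube_action n \<phi> g ` ?S))"
    using continuous_map_image_closure_subset[OF continuous_map_cube_action[OF g], of ?S]
      imageI[OF z, of "cube_action n \<phi> g"] unfolding dynamical_cubes_def by (rule subsetD)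
  moreover have "cube_action n \<phi> g ` ?S \<subseteq> ?S"
  proof clarsimp
    fix h x assume h: "h \<in> Host_Kra_group G n" and x: "x \<in> topspace X"
    have "cube_action n \<phi> g (cube_action n \<phi> h (const_config n x)) =
      cube_action n \<phi> (g \<otimes>\<^bsub>cube_group n G\<^esub> h) (const_config n x)"
      using Host_Kra_group_coordinate[OF g] Host_Kra_group_coordinate[OF h] x
      by (auto simp: cube_action_def const_config_def cube_group_mult_apply composition_rule fun_eq_iff)
    then show "\<exists>k y. cube_action n \<phi> g (cube_action n \<phi> h (const_config n x)) =
      cube_action n \<phi> k (const_config n y) \<and> k \<in> Host_Kra_group G n \<and> y \<in> topspace X"
      using Host_Kra_group_mult[OF g h] x by blast
  qed
  ultimately show ?thesis
    unfolding dynamical_cubes_def using closure_of_mono by blast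
qed

text \<open>For fixed \<open>z\<close> the evaluation is continuous in \<open>P\<close>, and the
  cubes form a closed set invariant under the Host-Kra group.\<close>

lemma family_apply_in_dynamical_cubes:
  assumes P: "P \<in> cube_ellis n" and z: "z \<in> dynamical_cubes G X \<phi> n"
  shows "family_apply (discrete_cube n) P z \<in> dynamical_cubes G X \<phi> n"
proof (rule enveloping_image[OF P])
  show "continuous_map (family_topology (discrete_cube n) X) (cube_topology n X)
      (\<lambda>P. family_apply (discrete_cube n) P z)"
    unfolding cube_topology_def
    using dynamical_cubes_in_topspace[OF z] by (intro continuous_map_family_apply) auto
  show "closedin (cube_topology n X) (dynamical_cubes G X \<phi> n)" by (rule closedin_dynamical_cubes)
  fix g assume g: "g \<in> Host_Kra_group G n"
  have "family_apply (discrete_cube n) (family_action (discrete_cube n) X \<phi> g) z = cube_action n \<phi> g z"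
    using dynamical_cubes_in_topspace[OF z]
    by (auto simp: family_apply_def family_action_def cube_action_def)
  then show "family_apply (discrete_cube n) (family_action (discrete_cube n) X \<phi> g) z \<in> dynamical_cubes G X \<phi> n"
    using cube_action_in_dynamical_cubes[OF g z] by simp
qed

lemma ellis_apply_in_topspace:
  "p \<in> ellis \<Longrightarrow> x \<in> topspace X \<Longrightarrow> p ((), x) \<in> topspace X"
  by (rule enveloping_in_topspace[OF _ singletonI])

lemma dynamical_cubes_extensional:
  assumes "z \<in> dynamical_cubes G X \<phi> n"
  shows "z \<in> extensional (discrete_cube n)"
  using closedin_subset[OF closedin_dynamical_cubes[of n]] assms
  by (auto simp: cube_topology_def PiE_iff)

lemma diagonal_corner_in_dynamical_cubes:
  assumes p: "p \<in> ellis" and n: "n \<ge> 1" and ab: "corner_config n a b \<in> dynamical_cubes G X \<phi> n"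
    and "a \<in> topspace X" "b \<in> topspace X"
  shows "corner_config n (p ((), a)) (p ((), b)) \<in> dynamical_cubes G X \<phi> n"
proof -
  have "family_apply (discrete_cube n) (diagonal_family n p) (corner_config n a b) =
    corner_config n (p ((), a)) (p ((), b))"
    using assms(4,5) by (auto simp: family_apply_def family_reindex_def corner_config_def)
  then show ?thesis
    using family_apply_in_dynamical_cubes[OF diagonal_family_in_cube_ellis[OF p n] ab] by simp
qed

text \<open>\<open>u\<close> is applied along one lower face after another. A vertex lying on
  several of these faces is hit repeatedly, but idempotence makes the result the same as a single
  application.\<close>

lemma lower_faces_in_dynamical_cubes:
  assumes u: "u \<in> ellis" "family_comp {()} X u u = u"
    and z: "z \<in> dynamical_cubes G X \<phi> n" and J: "finite J" "J \<subseteq> {1..n}"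
  shows "(\<lambda>\<omega>\<in>discrete_cube n. if \<exists>i\<in>J. \<omega> i = 0 then u ((), z \<omega>) else z \<omega>) \<in> dynamical_cubes G X \<phi> n"
  using J
proof (induction J rule: finite_induct)
  case empty
  show ?case using z extensional_restrict[OF dynamical_cubes_extensional[OF z]] by simp
next
  case (insert i J)
  let ?z = "\<lambda>\<omega>\<in>discrete_cube n. if \<exists>i\<in>J. \<omega> i = 0 then u ((), z \<omega>) else z \<omega>"
  let ?F = "{\<omega> \<in> discrete_cube n. \<omega> i = 0}"
  let ?P = "family_reindex (discrete_cube n) X (\<lambda>\<omega>. if \<omega> \<in> ?F then Some () else None) u"
  have F: "?F \<in> hyperfaces n" using insert.prems by (intro hyperface_lower) simp
  have uu: "u ((), u ((), z \<omega>)) = u ((), z \<omega>)" if "\<omega> \<in> discrete_cube n" for \<omega>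
    using family_comp_apply[of "()" "{()}" "z \<omega>" X u u] dynamical_cubes_in_topspace[OF z that] u(2) by simp
  have top: "?z \<in> discrete_cube n \<rightarrow> topspace X"
    using dynamical_cubes_in_topspace[OF z] ellis_apply_in_topspace[OF u(1)] by auto
  have "family_apply (discrete_cube n) ?P ?z \<omega> =
      (if \<exists>i\<in>insert i J. \<omega> i = 0 then u ((), z \<omega>) else z \<omega>)" if "\<omega> \<in> discrete_cube n" for \<omega>
    unfolding family_apply_reindex[OF top that] using that uu[OF that] by auto
  then have "family_apply (discrete_cube n) ?P ?z =
      (\<lambda>\<omega>\<in>discrete_cube n. if \<exists>i\<in>insert i J. \<omega> i = 0 then u ((), z \<omega>) else z \<omega>)"
    by (intro extensionalityI[of _ "discrete_cube n"]) (auto simp: family_apply_def)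
  moreover have "?z \<in> dynamical_cubes G X \<phi> n" using insert.IH insert.prems by blast
  ultimately show ?case
    using family_apply_in_dynamical_cubes[OF face_family_in_cube_ellis[OF u(1) F], of ?z] by metis
qed

text \<open>
  Every vertex other than \<open>(1, \<dots>, 1)\<close> lies on a lower face, and \<open>u\<close> acts on all lower faces in turn.
\<close>

lemma idempotent_corner_in_dynamical_cubes:
  assumes u: "u \<in> ellis" "family_comp {()} X u u = u"
    and ab: "corner_config n a b \<in> dynamical_cubes G X \<phi> n"
  shows "corner_config n (u ((), a)) b \<in> dynamical_cubes G X \<phi> n"
proof -
  have "(\<lambda>\<omega>\<in>discrete_cube n. if \<exists>i\<in>{1..n}. \<omega> i = 0
      then u ((), corner_config n a b \<omega>) else corner_config n a b \<omega>) = corner_config n (u ((), a)) b"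
  proof (rule extensionalityI[of _ "discrete_cube n"])
    fix \<omega> assume \<omega>: "\<omega> \<in> discrete_cube n"
    show "(\<lambda>\<omega>\<in>discrete_cube n. if \<exists>i\<in>{1..n}. \<omega> i = 0
      then u ((), corner_config n a b \<omega>) else corner_config n a b \<omega>) \<omega> = corner_config n (u ((), a)) b \<omega>"
    proof (cases "\<omega> = (\<lambda>i \<in> {1..n}. 1)")
      case True
      then show ?thesis using discrete_cube_ones by (simp add: corner_config_def)
    next
      case False
      moreover obtain i where "i \<in> {1..n}" "\<omega> i = 0" using discrete_cube_not_ones[OF \<omega> False] .
      then have "\<exists>i\<in>{1..n}. \<omega> i = 0" by blast
      ultimately show ?thesis using \<omega> by (simp add: corner_config_def)
    qed
  qed (simp_all add: corner_config_def)
  then show ?thesis using lower_faces_in_dynamical_cubes[OF u ab, of "{1..n}"] by simp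
qed

end

section \<open>Transitivity and minimality of the enveloping semigroups\<close>

context minimal_tds
begin

text \<open>The values at \<open>x\<close> form a closed set containing the dense orbit of
  \<open>x\<close>.\<close>

lemma ellis_transitive:
  assumes x: "x \<in> topspace X" and y: "y \<in> topspace X"
  obtains p where "p \<in> ellis" "p ((), x) = y"
proof -
  let ?K = "(\<lambda>p. p ((), x)) ` ellis"
  have "closedin X ?K"
    using x by (intro point.closedin_enveloping_image continuous_map_family_coordinate Hausdorff_phase) auto
  moreover have "orbit G \<phi> x \<subseteq> ?K"
  proof
    fix y assume "y \<in> orbit G \<phi> x"
    then obtain g where g: "g \<in> carrier G" "y = \<phi> g x" by (auto simp: orbit_def)
    have "family_action {()} X \<phi> (\<lambda>_. g) \<in> ellis"
      using g(1) by (intro family_action_in_enveloping) auto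
    then show "y \<in> ?K" by (rule rev_image_eqI) (use g x in \<open>simp add: family_action_def\<close>)
  qed
  ultimately have "topspace X \<subseteq> ?K"
    using closure_of_minimal[of "orbit G \<phi> x" ?K X] minimal[OF x] by simp
  then show thesis using that y by blast
qed

text \<open>The elements of \<open>M\<close> fixing \<open>x\<close> form a closed subsemigroup. It
  is nonempty: for \<open>q\<close> in \<open>M\<close>, some \<open>s\<close> returns
  \<open>q x\<close> to \<open>x\<close>, and \<open>s q\<close> stays in the left ideal
  \<open>M\<close>. An idempotent in it is the one sought.\<close>

lemma idempotent_fixing_point:
  assumes M: "point.E.minimal_left_ideal M" and x: "x \<in> topspace X"
  obtains u where "u \<in> M" "family_comp {()} X u u = u" "u ((), x) = x"
proof -
  let ?W = "subtopology (family_topology {()} X) ellis"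
  note mult = point.E.minimal_left_ideal_mult[OF M, unfolded point.topspace_enveloping]
  note M_ellis = point.E.minimal_left_idealD(2)[OF M, unfolded point.topspace_enveloping]
  let ?K = "{p \<in> M. p ((), x) = x}"
  have "continuous_map ?W X (\<lambda>p. p ((), x))"
    using x by (intro continuous_map_from_subtopology continuous_map_family_coordinate) auto
  then have "closedin ?W {p \<in> topspace ?W. p ((), x) \<in> {x}}"
    by (rule closedin_continuous_map_preimage) (rule closedin_Hausdorff_singleton[OF Hausdorff_phase x])
  then have "closedin ?W (M \<inter> {p \<in> topspace ?W. p ((), x) \<in> {x}})"
    by (intro closedin_Int point.E.minimal_left_ideal_closedin[OF M])
  moreover have "M \<inter> {p \<in> topspace ?W. p ((), x) \<in> {x}} = ?K"
    unfolding point.topspace_enveloping using subsetD[OF M_ellis] by auto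
  ultimately have "closedin ?W ?K" by simp
  moreover have "?K \<noteq> {}"
  proof -
    obtain q where q: "q \<in> M" using point.E.minimal_left_idealD(1)[OF M] by blast
    have qx: "q ((), x) \<in> topspace X" using subsetD[OF M_ellis q] x by (rule ellis_apply_in_topspace)
    obtain s where s: "s \<in> ellis" "s ((), q ((), x)) = x" using ellis_transitive[OF qx x] .
    have "family_comp {()} X s q \<in> M"
      using s(1) q by (rule mult)
    moreover have "family_comp {()} X s q ((), x) = x" using s(2) x by (simp add: family_comp_apply)
    ultimately show ?thesis by blast
  qed
  moreover have "family_comp {()} X p q \<in> ?K" if p: "p \<in> ?K" and q: "q \<in> ?K" for p q
  proof -
    have "p \<in> ellis" using p subsetD[OF M_ellis] by simp
    then have "family_comp {()} X p q \<in> M" using q by (intro mult) simp_all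
    moreover have "family_comp {()} X p q ((), x) = x" using p q x by (simp add: family_comp_apply)
    ultimately show ?thesis by blast
  qed
  ultimately obtain u where "u \<in> ?K" "family_comp {()} X u u = u"
    by (rule point.E.idempotent_exists)
  then show thesis by (intro that[of u]) simp_all
qed

text \<open>The configurations reached from the constant \<open>x\<close> form a closed set. It
  contains every generating cube \<open>g y\<close>, reached by first moving \<open>x\<close> to
  \<open>y\<close> diagonally and then applying \<open>g\<close>.\<close>

lemma dynamical_cubes_transitive:
  assumes z: "z \<in> dynamical_cubes G X \<phi> n" and x: "x \<in> topspace X" and n: "n \<ge> 1"
  obtains Q where "Q \<in> cube_ellis n" "family_apply (discrete_cube n) Q (const_config n x) = z"
proof -
  let ?K = "(\<lambda>P. family_apply (discrete_cube n) P (const_config n x)) ` cube_ellis n"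
  have cx: "const_config n x \<in> discrete_cube n \<rightarrow> topspace X"
    using x by (simp add: const_config_def)
  have "Hausdorff_space (cube_topology n X)"
    unfolding cube_topology_def by (simp add: Hausdorff_space_product_topology Hausdorff_phase)
  then have "closedin (cube_topology n X) ?K"
    by (intro cube.closedin_enveloping_image)
      (use continuous_map_family_apply[OF cx] in \<open>simp_all add: cube_topology_def\<close>)
  moreover have "cube_action n \<phi> g (const_config n y) \<in> ?K"
    if g: "g \<in> Host_Kra_group G n" and y: "y \<in> topspace X" for g y
  proof -
    obtain p where p: "p \<in> ellis" "p ((), x) = y" using ellis_transitive[OF x y] .
    let ?g = "family_action (discrete_cube n) X \<phi> g"
    have "?g \<in> cube_ellis n"
      using family_action_in_enveloping[OF g, of "discrete_cube n"] Host_Kra_group_coordinate by simp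
    then have "family_comp (discrete_cube n) X ?g (diagonal_family n p) \<in> cube_ellis n"
      using diagonal_family_in_cube_ellis[OF p(1) n] by (rule cube.enveloping_mult_closed)
    moreover have "family_apply (discrete_cube n) (family_comp (discrete_cube n) X ?g (diagonal_family n p))
        (const_config n x) = cube_action n \<phi> g (const_config n y)"
      using x y p(2) by (auto simp: family_apply_def family_comp_def family_action_def family_reindex_def
          const_config_def cube_action_def)
    ultimately show ?thesis by (metis (no_types, lifting) imageI)
  qed
  ultimately have "dynamical_cubes G X \<phi> n \<subseteq> ?K"
    unfolding dynamical_cubes_def by (intro closure_of_minimal) auto
  then show thesis using that z by blast
qed

text \<open>
  The cubes form a minimal system of the Host-Kra group: a minimal idempotent \<open>u\<close> fixing \<open>x\<close> acts
  diagonally as a minimal idempotent of the enveloping semigroup of that group, because an idempotent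
  \<open>V = V U\<close> with \<open>U\<close> the diagonal of \<open>u\<close> has all its coordinates in the minimal left ideal of \<open>u\<close>.
\<close>

lemma dynamical_cubes_minimal:
  assumes z: "z \<in> dynamical_cubes G X \<phi> n" and x: "x \<in> topspace X" and n: "n \<ge> 1"
  obtains P where "P \<in> cube_ellis n" "family_apply (discrete_cube n) P z = const_config n x"
proof -
  let ?I = "discrete_cube n"
  note top = point.topspace_enveloping cube.topspace_enveloping
  obtain M where M: "point.E.minimal_left_ideal M"
    using point.enveloping_nonempty point.E.minimal_left_ideal_exists unfolding top by blast
  obtain u where u: "u \<in> M" "family_comp {()} X u u = u" "u ((), x) = x"
    using idempotent_fixing_point[OF M x] .
  have u_ellis: "u \<in> ellis" using point.E.minimal_left_idealD(2)[OF M] u(1) unfolding top by blast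
  define U where "U = diagonal_family n u"
  have U: "U \<in> cube_ellis n" unfolding U_def using u_ellis n by (rule diagonal_family_in_cube_ellis)
  have UU: "family_comp ?I X U U = U"
    using family_comp_reindex[OF _ subsetD[OF enveloping_subset_topspace u_ellis], of ?I "\<lambda>_. Some ()" u] u(2)
    unfolding U_def by simp
  obtain L where L: "cube.E.minimal_left_ideal n L" and LU: "L \<subseteq> (\<lambda>s. family_comp ?I X s U) ` cube_ellis n"
    using cube.E.minimal_left_ideal_exists[of U n] U unfolding top by blast
  have L_ellis: "L \<subseteq> cube_ellis n" using cube.E.minimal_left_idealD(2)[OF L] unfolding top .
  obtain V where V: "V \<in> L" "family_comp ?I X V V = V"
  proof (rule cube.E.idempotent_exists[OF cube.E.minimal_left_ideal_closedin[OF L] cube.E.minimal_left_idealD(1)[OF L]])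
    show "family_comp ?I X p q \<in> L" if "p \<in> L" "q \<in> L" for p q
      using cube.E.minimal_left_ideal_mult[OF L _ that(2)] L_ellis that(1) unfolding top by blast
  qed
  have V_ellis: "V \<in> cube_ellis n" using V(1) L_ellis by blast
  \<comment> \<open>\<open>V\<close> has the form \<open>S U\<close> because \<open>L\<close> was
    chosen inside the left ideal generated by \<open>U\<close>.\<close>
  have VU: "family_comp ?I X V U = V"
  proof -
    obtain S where S: "S \<in> cube_ellis n" "V = family_comp ?I X S U" using V(1) LU by blast
    moreover have "U \<in> topspace (family_topology ?I X)" using enveloping_subset_topspace U by (rule subsetD)
    ultimately show ?thesis using UU family_comp_assoc[of U ?I X U S] by simp
  qed
  \<comment> \<open>The component of \<open>V\<close> at \<open>\<omega>\<close> is idempotent and,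
    by \<open>V U = V\<close>, lies in \<open>M\<close>; as an idempotent of \<open>M\<close> it is
    a right identity for \<open>u\<close>.\<close>
  have uV: "u ((), V (\<omega>, y)) = u ((), y)" if \<omega>: "\<omega> \<in> ?I" and y: "y \<in> topspace X" for \<omega> y
  proof -
    let ?r = "family_reindex {()} X (\<lambda>_::unit. Some \<omega>)"
    have r_comp: "?r (family_comp ?I X P Q) = family_comp {()} X (?r P) (?r Q)"
      if "Q \<in> cube_ellis n" for P Q
      using family_comp_reindex[OF _ subsetD[OF enveloping_subset_topspace that], of "{()}" "\<lambda>_. Some \<omega>" P] \<omega>
      by simp
    have "?r U = u"
    proof (rule extensionalityI[of _ "{()} \<times> topspace X"])
      show "u \<in> extensional ({()} \<times> topspace X)"
        using subsetD[OF enveloping_subset_topspace u_ellis] by (simp add: topspace_family_topology PiE_iff)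
    qed (use \<omega> in \<open>auto simp: family_reindex_def U_def\<close>)
    then have "?r V = family_comp {()} X (?r V) u" using r_comp[OF U, of V] VU by simp
    then have "?r V \<in> M"
      using point.E.minimal_left_ideal_mult[OF M _ u(1), of "?r V"] coordinate_in_ellis[OF V_ellis \<omega>]
      unfolding top by simp
    moreover have "family_comp {()} X (?r V) (?r V) = ?r V" using r_comp[OF V_ellis, of V] V(2) by simp
    ultimately have "family_comp {()} X u (?r V) = u"
      using point.E.minimal_left_ideal_right_identity[OF M _ u(1)] by blast
    from arg_cong[OF this, of "\<lambda>p. p ((), y)"] show ?thesis
      using y by (simp add: family_comp_apply family_reindex_def)
  qed
  have "family_comp ?I X U V = U"
    using uV enveloping_in_topspace[OF V_ellis]
    by (auto simp: U_def family_comp_def family_reindex_def)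
  then have "U \<in> L" using cube.E.minimal_left_ideal_mult[OF L _ V(1), of U] U unfolding top by simp
  obtain Q where Q: "Q \<in> cube_ellis n" "family_apply ?I Q (const_config n x) = z"
    using dynamical_cubes_transitive[OF z x n] .
  \<comment> \<open>Since \<open>U\<close> is now known to lie in \<open>L\<close>, so does
    \<open>Q U\<close>, and some \<open>R\<close> carries it back to \<open>U\<close>. As
    \<open>U\<close> fixes the constant \<open>x\<close>, \<open>z\<close> equals \<open>Q U\<close>
    at that constant, and \<open>R\<close> returns \<open>z\<close> to it.\<close>
  have "family_comp ?I X Q U \<in> L"
    using cube.E.minimal_left_ideal_mult[OF L _ \<open>U \<in> L\<close>, of Q] Q(1) unfolding top by simp
  then obtain R where R: "R \<in> cube_ellis n" "family_comp ?I X R (family_comp ?I X Q U) = U"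
    using cube.E.minimal_left_ideal_transitive[OF L _ \<open>U \<in> L\<close>] unfolding top by metis
  have cx: "const_config n x \<in> ?I \<rightarrow> topspace X" using x by (simp add: const_config_def)
  have Ux: "family_apply ?I U (const_config n x) = const_config n x"
    using x u(3) by (auto simp: family_apply_def U_def family_reindex_def const_config_def)
  have "family_apply ?I R z = family_apply ?I R (family_apply ?I Q (family_apply ?I U (const_config n x)))"
    using Q(2) Ux by simp
  also have "\<dots> = family_apply ?I (family_comp ?I X R (family_comp ?I X Q U)) (const_config n x)"
    using family_apply_comp[OF cx] by simp
  also have "\<dots> = const_config n x" using R(2) Ux by simp
  finally show thesis using that R(1) by blast
qed

end

section \<open>Lifting through extensions\<close>

locale minimal_extension =
  X: minimal_tds G T X \<phi> + Y: minimal_tds G T Y \<psi>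
  for G :: "('a, 'm) monoid_scheme" (structure) and T
    and X :: "'x topology" and \<phi> and Y :: "'y topology" and \<psi> +
  fixes \<pi> :: "'x \<Rightarrow> 'y"
  assumes nonempty: "topspace X \<noteq> {}"
    and morphism: "dynamical_morphism G X \<phi> Y \<psi> \<pi>"
begin

lemma continuous_map_extension: "continuous_map X Y \<pi>"
  using morphism by (simp add: dynamical_morphism_def)

lemma extension_equivariant:
  "g \<in> carrier G \<Longrightarrow> x \<in> topspace X \<Longrightarrow> \<pi> (\<phi> g x) = \<psi> g (\<pi> x)"
  using morphism by (simp add: dynamical_morphism_def)

lemma extension_in_topspace: "x \<in> topspace X \<Longrightarrow> \<pi> x \<in> topspace Y"
  using continuous_map_image_subset_topspace[OF continuous_map_extension] by blast

text \<open>The image is compact, hence closed, and contains the dense orbit of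
  \<open>\<pi> x0\<close>; nonemptiness of \<open>X\<close> provides \<open>x0\<close>.\<close>

lemma extension_surj:
  assumes "y \<in> topspace Y"
  obtains x where "x \<in> topspace X" "\<pi> x = y"
proof -
  obtain x0 where x0: "x0 \<in> topspace X" using nonempty by blast
  have "closedin Y (\<pi> ` topspace X)"
    using continuous_imp_closed_map[OF continuous_map_extension X.compact_phase Y.Hausdorff_phase]
    unfolding closed_map_def by blast
  moreover have "orbit G \<psi> (\<pi> x0) \<subseteq> \<pi> ` topspace X"
    using x0 X.action_closed by (auto simp: orbit_def extension_equivariant[symmetric])
  ultimately have "topspace Y \<subseteq> \<pi> ` topspace X"
    using closure_of_minimal[of "orbit G \<psi> (\<pi> x0)" "\<pi> ` topspace X" Y]
      Y.minimal[OF extension_in_topspace[OF x0]] by simp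
  then show thesis using that assms by blast
qed

text \<open>Group elements respect fibres by equivariance, and equality of two continuous maps into
  the Hausdorff space \<open>Y\<close> is a closed condition. This takes the place of an induced map
  between the enveloping semigroups of \<open>X\<close> and \<open>Y\<close>.\<close>

lemma ellis_respects_extension:
  assumes p: "p \<in> X.ellis" and x: "x \<in> topspace X" "x' \<in> topspace X" and eq: "\<pi> x = \<pi> x'"
  shows "\<pi> (p ((), x)) = \<pi> (p ((), x'))"
proof -
  let ?W = "family_topology {()} X"
  have cont: "continuous_map ?W Y (\<lambda>p. \<pi> (p ((), x)))" if "x \<in> topspace X" for x
    using continuous_map_compose[OF continuous_map_family_coordinate[of "()" "{()}" x X] continuous_map_extension] that
    by (simp add: o_def)
  \<comment> \<open>The identity map is written out so that the statement has the shape
    \<open>f P \<in> K\<close> of \<open>enveloping_image\<close>.\<close>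
  have "(\<lambda>p. p) p \<in> {p \<in> topspace ?W. \<pi> (p ((), x)) = \<pi> (p ((), x'))}"
  proof (rule X.enveloping_image[OF p])
    show "closedin ?W {p \<in> topspace ?W. \<pi> (p ((), x)) = \<pi> (p ((), x'))}"
      using x by (intro closedin_continuous_maps_eq[OF Y.Hausdorff_phase] cont)
    fix g :: "unit \<Rightarrow> 'a" assume "g \<in> (\<lambda>g _. g) ` carrier G"
    then have "g () \<in> carrier G" by auto
    then show "family_action {()} X \<phi> g \<in> {p \<in> topspace ?W. \<pi> (p ((), x)) = \<pi> (p ((), x'))}"
      using X.family_action_in_topspace[of "{()}" g] x eq
      by (simp add: family_action_def extension_equivariant)
  qed simp
  then show ?thesis by simp
qed

section \<open>Lifting dynamical cubes and corners along the extension\<close>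

abbreviation cube_extension :: "nat \<Rightarrow> ((nat \<Rightarrow> nat) \<Rightarrow> 'x) \<Rightarrow> (nat \<Rightarrow> nat) \<Rightarrow> 'y"
  where "cube_extension n c \<equiv> (\<lambda>\<omega>\<in>discrete_cube n. \<pi> (c \<omega>))"

lemma continuous_map_cube_extension:
  "continuous_map (cube_topology n X) (cube_topology n Y) (cube_extension n)"
proof -
  have "continuous_map (cube_topology n X) Y (\<lambda>c. \<pi> (c \<omega>))" if "\<omega> \<in> discrete_cube n" for \<omega>
    using continuous_map_compose[OF continuous_map_product_projection[OF that] continuous_map_extension]
    by (simp add: cube_topology_def o_def)
  then show ?thesis
    unfolding cube_topology_def[of n Y] continuous_map_componentwise by auto
qed

text \<open>One inclusion is continuity. For the other, the image is closed by compactness and, by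
  surjectivity of \<open>\<pi>\<close>, contains all generating cubes over \<open>Y\<close>.\<close>

lemma cube_extension_dynamical_cubes:
  "cube_extension n ` dynamical_cubes G X \<phi> n = dynamical_cubes G Y \<psi> n"
proof -
  let ?SX = "{cube_action n \<phi> g (const_config n x) | g x. g \<in> Host_Kra_group G n \<and> x \<in> topspace X}"
  let ?SY = "{cube_action n \<psi> g (const_config n y) | g y. g \<in> Host_Kra_group G n \<and> y \<in> topspace Y}"
  have push: "cube_extension n (cube_action n \<phi> g (const_config n x)) = cube_action n \<psi> g (const_config n (\<pi> x))"
    if "g \<in> Host_Kra_group G n" "x \<in> topspace X" for g x
    using that X.Host_Kra_group_coordinate
    by (auto simp: cube_action_def const_config_def extension_equivariant)
  have top: "?SX \<subseteq> topspace (cube_topology n X)"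
    using X.action_closed X.Host_Kra_group_coordinate
    by (auto simp: cube_topology_def cube_action_def const_config_def)
  show ?thesis
  proof
    have "cube_extension n ` ?SX \<subseteq> ?SY" using push extension_in_topspace by blast
    then show "cube_extension n ` dynamical_cubes G X \<phi> n \<subseteq> dynamical_cubes G Y \<psi> n"
      unfolding dynamical_cubes_def
      by (rule order.trans[OF continuous_map_image_closure_subset[OF continuous_map_cube_extension] closure_of_mono])
  next
    have "compact_space (cube_topology n X)" "Hausdorff_space (cube_topology n Y)"
      unfolding cube_topology_def
      by (simp_all add: compact_space_product_topology X.compact_phase
          Hausdorff_space_product_topology Y.Hausdorff_phase)
    then have "closedin (cube_topology n Y) (cube_extension n ` dynamical_cubes G X \<phi> n)"
      using continuous_imp_closed_map[OF continuous_map_cube_extension] X.closedin_dynamical_cubes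
      unfolding closed_map_def by blast
    moreover have "?SY \<subseteq> cube_extension n ` dynamical_cubes G X \<phi> n"
    proof clarify
      fix g y assume g: "g \<in> Host_Kra_group G n" and y: "y \<in> topspace Y"
      obtain x where x: "x \<in> topspace X" "\<pi> x = y" using extension_surj[OF y] .
      have "?SX \<subseteq> dynamical_cubes G X \<phi> n"
        unfolding dynamical_cubes_def using top by (rule closure_of_subset)
      then have "cube_action n \<phi> g (const_config n x) \<in> dynamical_cubes G X \<phi> n" using g x(1) by blast
      then show "cube_action n \<psi> g (const_config n y) \<in> cube_extension n ` dynamical_cubes G X \<phi> n"
        using push[OF g x(1)] x(2) by (intro image_eqI) auto
    qed
    ultimately show "dynamical_cubes G Y \<psi> n \<subseteq> cube_extension n ` dynamical_cubes G X \<phi> n"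
      unfolding dynamical_cubes_def[of G Y] by (intro closure_of_minimal)
  qed
qed

lemma cube_extension_corner:
  "cube_extension n (corner_config n a b) = corner_config n (\<pi> a) (\<pi> b)"
  by (auto simp: corner_config_def)

text \<open>
  Let \<open>P\<close> move a cube to a constant configuration. Its part on the facet \<open>\<omega>\<^sub>i = 0\<close>, doubled in direction
  \<open>i\<close>, makes that facet constant and keeps the facets that were already constant. Its components
  at \<open>(1, \<dots>, 1)\<close> and at the neighbour in direction \<open>i\<close> agree, so that over \<open>Y\<close> both values of
  the corner are moved by the same element.
\<close>

lemma corner_over_left_ideal:
  assumes M: "X.point.E.minimal_left_ideal M" and n: "n \<ge> 1"
    and x: "x \<in> topspace X" and x': "x' \<in> topspace X" and p0: "p0 \<in> M"
    and z0: "z0 \<in> dynamical_cubes G X \<phi> n"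
    and \<pi>_z0: "cube_extension n z0 = corner_config n (\<pi> (p0 ((), x))) (\<pi> (p0 ((), x')))"
  obtains a b p where "p \<in> M" "a \<in> topspace X" "b \<in> topspace X"
    "corner_config n a b \<in> dynamical_cubes G X \<phi> n"
    "\<pi> a = \<pi> (p ((), x))" "\<pi> b = \<pi> (p ((), x'))"
proof -
  let ?I = "discrete_cube n"
  let ?one = "\<lambda>i\<in>{1..n}. 1 :: nat"
  have M_ellis: "M \<subseteq> X.ellis"
    using X.point.E.minimal_left_idealD(2)[OF M] unfolding X.point.topspace_enveloping .
  have proper: "fun_upd \<omega> i 0 \<noteq> ?one" if "i \<in> {1..n}" for \<omega> :: "nat \<Rightarrow> nat" and i
  proof
    assume "fun_upd \<omega> i 0 = ?one"
    from fun_cong[OF this, of i] show False using that by simp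
  qed
  \<comment> \<open>Induction invariant for the set \<open>J\<close> of directions already treated.
    The constant \<open>a\<close> and the element \<open>p\<close> are existential because each step
    replaces them, by \<open>x\<close> and by \<open>q p\<close>.\<close>
  have "\<exists>z\<in>dynamical_cubes G X \<phi> n. \<exists>a\<in>topspace X. \<exists>p\<in>M.
      (\<forall>\<omega>\<in>?I. \<omega> \<noteq> ?one \<longrightarrow> \<pi> (z \<omega>) = \<pi> (p ((), x))) \<and> \<pi> (z ?one) = \<pi> (p ((), x')) \<and>
      (\<forall>\<omega>\<in>?I. (\<exists>i\<in>J. \<omega> i = 0) \<longrightarrow> z \<omega> = a)"
    if "finite J" "J \<subseteq> {1..n}" for J
    using that
  proof (induction J rule: finite_induct)
    case empty
    have val: "\<pi> (z0 \<omega>) = corner_config n (\<pi> (p0 ((), x))) (\<pi> (p0 ((), x'))) \<omega>" if "\<omega> \<in> ?I" for \<omega>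
      using fun_cong[OF \<pi>_z0, of \<omega>] that by simp
    have "\<forall>\<omega>\<in>?I. \<omega> \<noteq> ?one \<longrightarrow> \<pi> (z0 \<omega>) = \<pi> (p0 ((), x))"
      using val by (simp add: corner_config_def)
    moreover have "\<pi> (z0 ?one) = \<pi> (p0 ((), x'))"
      using val[OF discrete_cube_ones] discrete_cube_ones[of n] by (simp add: corner_config_def)
    ultimately show ?case using z0 p0 x by blast
  next
    case (insert i J)
    then have "J \<subseteq> {1..n}" by simp
    from insert.IH[OF this] obtain z a p
      where z: "z \<in> dynamical_cubes G X \<phi> n" and a: "a \<in> topspace X" and p: "p \<in> M"
      and z_lower: "\<forall>\<omega>\<in>?I. \<omega> \<noteq> ?one \<longrightarrow> \<pi> (z \<omega>) = \<pi> (p ((), x))"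
      and z_one: "\<pi> (z ?one) = \<pi> (p ((), x'))"
      and z_const: "\<forall>\<omega>\<in>?I. (\<exists>j\<in>J. \<omega> j = 0) \<longrightarrow> z \<omega> = a"
      by (elim bexE conjE)
    note z_lower = z_lower[rule_format]
    note z_const = z_const[rule_format, OF _ bexI]
    have i: "i \<in> {1..n}" using insert.prems by simp
    have p_ellis: "p \<in> X.ellis" using p M_ellis by blast
    obtain P where P: "P \<in> X.cube_ellis n" "family_apply ?I P z = const_config n x"
      using X.dynamical_cubes_minimal[OF z x n] .
    have Pz: "P (\<omega>, z \<omega>) = x" if "\<omega> \<in> ?I" for \<omega>
      using fun_cong[OF P(2), of \<omega>] that by (simp add: family_apply_def const_config_def)
    let ?D = "family_reindex ?I X (\<lambda>\<omega>. Some (fun_upd \<omega> i 0)) P"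
    let ?z = "family_apply ?I ?D z"
    note z_top = X.dynamical_cubes_in_topspace[OF z]
    have "?z \<in> dynamical_cubes G X \<phi> n"
      using X.doubling_in_cube_ellis[OF P(1) i] z by (rule X.family_apply_in_dynamical_cubes)
    have z_apply: "?z \<omega> = P (fun_upd \<omega> i 0, z \<omega>)" if "\<omega> \<in> ?I" for \<omega>
      using family_apply_reindex[OF _ that, of z X "\<lambda>\<omega>. Some (fun_upd \<omega> i 0)" P] z_top by simp
    have respects: "\<pi> (P (\<omega>, y)) = \<pi> (P (\<omega>, y'))"
      if "\<omega> \<in> ?I" "y \<in> topspace X" "y' \<in> topspace X" "\<pi> y = \<pi> y'" for \<omega> y y'
      using ellis_respects_extension[OF X.coordinate_in_ellis[OF P(1) that(1)] that(2-4)] that(2,3)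
      by (simp add: family_reindex_def)
    \<comment> \<open>On the new facet the projection fixes \<open>\<omega>\<close>. On an old facet
      both \<open>\<omega>\<close> and its projection carry the value \<open>a\<close> of
      \<open>z\<close>. Either way the component of \<open>P\<close> at the projection meets its own
      input and gives \<open>x\<close>.\<close>
    have const: "?z \<omega> = x" if \<omega>: "\<omega> \<in> ?I" and j: "j \<in> insert i J" "\<omega> j = 0" for \<omega> j
    proof -
      have up: "fun_upd \<omega> i 0 \<in> ?I" using \<omega> i by (rule discrete_cube_update)
      have "z \<omega> = z (fun_upd \<omega> i 0)"
      proof (cases "j = i")
        case True
        then show ?thesis using j(2) fun_upd_triv[of \<omega> i] by simp
      next
        case False
        then have "j \<in> J" "(fun_upd \<omega> i 0) j = 0" using j by auto
        then show ?thesis using z_const[OF up, of j] z_const[OF \<omega>, of j] j(2) by simp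
      qed
      then show ?thesis using z_apply[OF \<omega>] Pz[OF up] by simp
    qed
    \<comment> \<open>The component of \<open>P\<close> at the neighbour of
      \<open>(1, ..., 1)\<close>. After doubling it acts at both vertices, hence over
      \<open>\<pi> (p x)\<close> and over \<open>\<pi> (p x')\<close>.\<close>
    define q where "q = family_reindex {()} X (\<lambda>_::unit. Some (fun_upd ?one i 0)) P"
    have one_up: "fun_upd ?one i 0 \<in> ?I" using discrete_cube_ones i by (rule discrete_cube_update)
    have q: "q \<in> X.ellis" unfolding q_def using P(1) one_up by (rule X.coordinate_in_ellis)
    have q_apply: "q ((), y) = P (fun_upd ?one i 0, y)" if "y \<in> topspace X" for y
      using that by (simp add: q_def family_reindex_def)
    have qp: "family_comp {()} X q p \<in> M"
      using X.point.E.minimal_left_ideal_mult[OF M _ p, unfolded X.point.topspace_enveloping] q by blast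
    have px: "p ((), x) \<in> topspace X" "p ((), x') \<in> topspace X"
      using x x' by (auto intro: X.ellis_apply_in_topspace[OF p_ellis])
    have "\<pi> x = \<pi> (q ((), p ((), x)))"
      using respects[OF one_up z_top[OF one_up] px(1) z_lower[OF one_up proper[OF i]]] Pz[OF one_up] q_apply[OF px(1)]
      by simp
    then have qp_x: "\<pi> x = \<pi> (family_comp {()} X q p ((), x))" using x by (simp add: family_comp_apply)
    \<comment> \<open>Neither \<open>\<omega>\<close> nor its projection is the top vertex, so
      \<open>z\<close> has the same image in \<open>Y\<close> at both. At the projection,
      \<open>P\<close> sends the value of \<open>z\<close> to \<open>x\<close>.\<close>
    have "\<pi> (?z \<omega>) = \<pi> x" if \<omega>: "\<omega> \<in> ?I" "\<omega> \<noteq> ?one" for \<omega>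
    proof -
      have up: "fun_upd \<omega> i 0 \<in> ?I" using \<omega>(1) i by (rule discrete_cube_update)
      have "\<pi> (z \<omega>) = \<pi> (z (fun_upd \<omega> i 0))"
        using z_lower[OF \<omega>] z_lower[OF up proper[OF i]] by simp
      then show ?thesis
        using respects[OF up z_top[OF \<omega>(1)] z_top[OF up]] z_apply[OF \<omega>(1)] Pz[OF up] by simp
    qed
    then have "\<forall>\<omega>\<in>?I. \<omega> \<noteq> ?one \<longrightarrow> \<pi> (?z \<omega>) = \<pi> (family_comp {()} X q p ((), x))"
      using qp_x by simp
    moreover have "\<pi> (?z ?one) = \<pi> (family_comp {()} X q p ((), x'))"
      using respects[OF one_up z_top[OF discrete_cube_ones] px(2) z_one] z_apply[OF discrete_cube_ones]
        q_apply[OF px(2)] x' by (simp add: family_comp_apply)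
    moreover have "\<forall>\<omega>\<in>?I. (\<exists>j\<in>insert i J. \<omega> j = 0) \<longrightarrow> ?z \<omega> = x" using const by blast
    ultimately show ?case using \<open>?z \<in> dynamical_cubes G X \<phi> n\<close> x qp by blast
  qed
  from this[OF finite_atLeastAtMost subset_refl] obtain z a p
    where z: "z \<in> dynamical_cubes G X \<phi> n" and a: "a \<in> topspace X" and p: "p \<in> M"
    and z_lower: "\<forall>\<omega>\<in>?I. \<omega> \<noteq> ?one \<longrightarrow> \<pi> (z \<omega>) = \<pi> (p ((), x))"
    and z_one: "\<pi> (z ?one) = \<pi> (p ((), x'))"
    and z_const: "\<forall>\<omega>\<in>?I. (\<exists>i\<in>{1..n}. \<omega> i = 0) \<longrightarrow> z \<omega> = a"
    by (elim bexE conjE)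
  note z_lower = z_lower[rule_format]
  note z_const = z_const[rule_format, OF _ bexI]
  have z_a: "z \<omega> = a" if \<omega>: "\<omega> \<in> ?I" "\<omega> \<noteq> ?one" for \<omega>
  proof -
    obtain i where "i \<in> {1..n}" "\<omega> i = 0" using discrete_cube_not_ones[OF \<omega>] .
    then show ?thesis using z_const[OF \<omega>(1)] by simp
  qed
  have "z = corner_config n a (z ?one)"
    using X.dynamical_cubes_extensional[OF z] z_a
    by (intro extensionalityI[of _ ?I]) (simp_all add: corner_config_def)
  then have "corner_config n a (z ?one) \<in> dynamical_cubes G X \<phi> n" using z by simp
  \<comment> \<open>The neighbour of the top vertex in direction 1 witnesses that some vertex
    carries the value \<open>a\<close>.\<close>
  moreover have "\<pi> a = \<pi> (p ((), x))"
  proof -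
    have 1: "1 \<in> {1..n}" using n by simp
    note up = discrete_cube_update[OF discrete_cube_ones 1]
    show ?thesis using z_lower[OF up proper[OF 1]] z_a[OF up proper[OF 1]] by simp
  qed
  ultimately show thesis
    using that p a z_one X.dynamical_cubes_in_topspace[OF z discrete_cube_ones] by blast
qed

section \<open>The regionally proximal relation under the extension\<close>

lemma NRP_image_subset: "map_prod \<pi> \<pi> ` NRP G X \<phi> d \<subseteq> NRP G Y \<psi> d"
proof clarsimp
  fix a b assume "(a, b) \<in> NRP G X \<phi> d"
  then have ab: "a \<in> topspace X" "b \<in> topspace X"
    and corner: "corner_config (d + 1) a b \<in> dynamical_cubes G X \<phi> (d + 1)"
    by (auto simp: NRP_def)
  from corner have "corner_config (d + 1) (\<pi> a) (\<pi> b) \<in> dynamical_cubes G Y \<psi> (d + 1)"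
    unfolding cube_extension_dynamical_cubes[symmetric] cube_extension_corner[symmetric] by (rule imageI)
  then show "(\<pi> a, \<pi> b) \<in> NRP G Y \<psi> d"
    using ab extension_in_topspace by (simp add: NRP_def)
qed

lemma NRP_lift:
  assumes "(y, y') \<in> NRP G Y \<psi> d"
  obtains x x' where "(x, x') \<in> NRP G X \<phi> d" "\<pi> x = y" "\<pi> x' = y'"
proof -
  let ?C = "dynamical_cubes G X \<phi> (d + 1)"
  have y: "y \<in> topspace Y" "y' \<in> topspace Y"
    and corner: "corner_config (d + 1) y y' \<in> dynamical_cubes G Y \<psi> (d + 1)"
    using assms by (auto simp: NRP_def)
  obtain x where x: "x \<in> topspace X" "\<pi> x = y" using extension_surj[OF y(1)] .
  obtain x' where x': "x' \<in> topspace X" "\<pi> x' = y'" using extension_surj[OF y(2)] .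
  obtain M where M: "X.point.E.minimal_left_ideal M"
    using X.point.enveloping_nonempty X.point.E.minimal_left_ideal_exists
    unfolding X.point.topspace_enveloping by blast
  have M_ellis: "M \<subseteq> X.ellis"
    using X.point.E.minimal_left_idealD(2)[OF M] unfolding X.point.topspace_enveloping .
  obtain u where u: "u \<in> M" "family_comp {()} X u u = u" "u ((), x) = x"
    using X.idempotent_fixing_point[OF M x(1)] .
  obtain v where v: "v \<in> M" "family_comp {()} X v v = v" "v ((), x') = x'"
    using X.idempotent_fixing_point[OF M x'(1)] .
  have u_ellis: "u \<in> X.ellis" and v_ellis: "v \<in> X.ellis" using u(1) v(1) M_ellis by auto
  obtain z where z: "z \<in> ?C" "cube_extension (d + 1) z = corner_config (d + 1) y y'"
    using corner unfolding cube_extension_dynamical_cubes[symmetric] by (metis (no_types, lifting) imageE)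
  let ?z = "family_apply (discrete_cube (d + 1)) (X.diagonal_family (d + 1) u) z"
  have z': "?z \<in> ?C"
    using X.diagonal_family_in_cube_ellis[OF u_ellis] z(1) by (intro X.family_apply_in_dynamical_cubes) simp_all
  have z_top: "z \<in> discrete_cube (d + 1) \<rightarrow> topspace X"
    using X.dynamical_cubes_in_topspace[OF z(1)] by auto
  \<comment> \<open>Applying \<open>u\<close> diagonally moves both values by an element of
    \<open>M\<close>, so the facet induction starts with \<open>p0 = u\<close>.\<close>
  have "cube_extension (d + 1) ?z = corner_config (d + 1) (\<pi> (u ((), x))) (\<pi> (u ((), x')))"
  proof (rule extensionalityI[of _ "discrete_cube (d + 1)"])
    fix \<omega> assume \<omega>: "\<omega> \<in> discrete_cube (d + 1)"
    have "\<pi> (z \<omega>) = corner_config (d + 1) y y' \<omega>" using fun_cong[OF z(2), of \<omega>] \<omega> by simp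
    also have "\<dots> = (if \<omega> = (\<lambda>i\<in>{1..d + 1}. 1) then \<pi> x' else \<pi> x)"
      using \<omega> x(2) x'(2) by (simp add: corner_config_def)
    finally have "\<pi> (u ((), z \<omega>)) = (if \<omega> = (\<lambda>i\<in>{1..d + 1}. 1) then \<pi> (u ((), x')) else \<pi> (u ((), x)))"
      using ellis_respects_extension[OF u_ellis X.dynamical_cubes_in_topspace[OF z(1) \<omega>] x(1)]
        ellis_respects_extension[OF u_ellis X.dynamical_cubes_in_topspace[OF z(1) \<omega>] x'(1)]
      by presburger
    then show "cube_extension (d + 1) ?z \<omega> = corner_config (d + 1) (\<pi> (u ((), x))) (\<pi> (u ((), x'))) \<omega>"
      using \<omega> family_apply_reindex[OF z_top \<omega>, of "\<lambda>_. Some ()" u] by (simp add: corner_config_def)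
  qed (simp_all add: corner_config_def)
  then obtain a b p where p: "p \<in> M" and ab: "a \<in> topspace X" "b \<in> topspace X" "corner_config (d + 1) a b \<in> ?C"
    and \<pi>_ab: "\<pi> a = \<pi> (p ((), x))" "\<pi> b = \<pi> (p ((), x'))"
    by (rule corner_over_left_ideal[OF M le_add2 x(1) x'(1) u(1) z'])
  \<comment> \<open>Aiming at \<open>v\<close> makes the second coordinate correct at once, since
    \<open>v x' = x'\<close>; the first then lies over \<open>v x\<close> and is corrected by
    \<open>u\<close>.\<close>
  obtain r where r: "r \<in> X.ellis" "family_comp {()} X r p = v"
    using X.point.E.minimal_left_ideal_transitive[OF M p v(1)] unfolding X.point.topspace_enveloping .
  have p_ellis: "p \<in> X.ellis" using p M_ellis by blast
  have rp: "\<pi> (r ((), c)) = \<pi> (v ((), w))" if "c \<in> topspace X" "w \<in> topspace X" "\<pi> c = \<pi> (p ((), w))" for c w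
  proof -
    have "\<pi> (r ((), c)) = \<pi> (r ((), p ((), w)))"
      using that X.ellis_apply_in_topspace[OF p_ellis] by (intro ellis_respects_extension[OF r(1)]) auto
    also have "\<dots> = \<pi> (family_comp {()} X r p ((), w))" using that(2) by (simp add: family_comp_apply)
    finally show ?thesis using r(2) by simp
  qed
  have rab: "r ((), a) \<in> topspace X" "r ((), b) \<in> topspace X"
    using ab(1,2) X.ellis_apply_in_topspace[OF r(1)] by auto
  have "corner_config (d + 1) (r ((), a)) (r ((), b)) \<in> ?C"
    using ab by (intro X.diagonal_corner_in_dynamical_cubes[OF r(1)]) simp_all
  then have "corner_config (d + 1) (u ((), r ((), a))) (r ((), b)) \<in> ?C"
    by (rule X.idempotent_corner_in_dynamical_cubes[OF u_ellis u(2)])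
  then have "(u ((), r ((), a)), r ((), b)) \<in> NRP G X \<phi> d"
    using rab X.ellis_apply_in_topspace[OF u_ellis] by (simp add: NRP_def)
  moreover have "\<pi> (u ((), r ((), a))) = y"
  proof -
    have "\<pi> (u ((), r ((), a))) = \<pi> (u ((), v ((), x)))"
      using rp[OF ab(1) x(1) \<pi>_ab(1)] rab(1) X.ellis_apply_in_topspace[OF v_ellis x(1)]
      by (intro ellis_respects_extension[OF u_ellis])
    also have "\<dots> = \<pi> (family_comp {()} X u v ((), x))" using x(1) by (simp add: family_comp_apply)
    \<comment> \<open>\<open>v\<close> is a right identity on \<open>M\<close>, so
      \<open>u v x = u x = x\<close>. This needs \<open>u\<close> and \<open>v\<close> in the same
      minimal left ideal.\<close>
    also have "family_comp {()} X u v = u"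
      using X.point.E.minimal_left_ideal_right_identity[OF M v(1) u(1) v(2)] .
    finally show ?thesis using u(3) x(2) by simp
  qed
  moreover have "\<pi> (r ((), b)) = y'"
    using rp[OF ab(2) x'(1) \<pi>_ab(2)] v(3) x'(2) by simp
  ultimately show thesis using that by blast
qed

end

theorem theorem6p1:
  fixes G :: "('a, 'm) monoid_scheme"
    and T :: "'a topology"
    and X :: "'x topology" and \<phi> :: "'a \<Rightarrow> 'x \<Rightarrow> 'x"
    and Y :: "'y topology" and \<psi> :: "'a \<Rightarrow> 'y \<Rightarrow> 'y"
    and \<pi> :: "'x \<Rightarrow> 'y"
    and d :: nat
  assumes "minimal_tds G T X \<phi>"
    and "minimal_tds G T Y \<psi>"
    and "topspace X \<noteq> {}"
    and "dynamical_morphism G X \<phi> Y \<psi> \<pi>"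
    and "d \<ge> 1"
  shows "map_prod \<pi> \<pi> ` NRP G X \<phi> d = NRP G Y \<psi> d"
proof -
  interpret minimal_extension G T X \<phi> Y \<psi> \<pi>
    using assms(1-4) by (intro minimal_extension.intro minimal_extension_axioms.intro)
  show ?thesis
  proof
    show "map_prod \<pi> \<pi> ` NRP G X \<phi> d \<subseteq> NRP G Y \<psi> d" by (rule NRP_image_subset)
    show "NRP G Y \<psi> d \<subseteq> map_prod \<pi> \<pi> ` NRP G X \<phi> d"
    proof clarify
      fix y y' assume "(y, y') \<in> NRP G Y \<psi> d"
      then obtain x x' where "(x, x') \<in> NRP G X \<phi> d" "\<pi> x = y" "\<pi> x' = y'" by (rule NRP_lift)
      then show "(y, y') \<in> map_prod \<pi> \<pi> ` NRP G X \<phi> d" by force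
    qed
  qed
qed

end
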